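(* Let $R$ be a commutative ring with unity. The following conditions are equivalent: (1) For each $R$-algebra $S$ and for each left $S$-module $M$ for which $\mathrm{End}_S(M)$ is local, $\mathrm{Supp}\,M$ contains only one maximal ideal. (2) $R$ is a Gelfand ring. (3) For every $P\in\mathrm{Max}\,R$ the natural map $R\to R_P$ is surjective. When these conditions are satisfied, for each $R$-algebra $S$ and each left $S$-module $M$ for which $\mathrm{End}_S(M)$ is local, one has $M=M_P$ (i.e. the canonical map $M\to M_P$ is an isomorphism), where $P$ is the unique maximal ideal of $R$ in $\mathrm{Supp}\,M$.
   Context: $\mathrm{Max}\,R$ is the set of maximal ideals of $R$. $R$ is Gelfand if each prime ideal is contained in only one maximal ideal. $R$-algebras are associative and unital but not necessarily commutative. For a left $S$-module $M$, viewed as an $R$-module, $\mathrm{Supp}\,M=\{P\in\mathrm{Spec}\,R\mid M_P\neq 0\}$. A (possibly noncommutative) ring is local if it is nonzero and its non-units form a two-sided ideal. *)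

theory Defs
  imports "HOL-Algebra.Ideal" "HOL-Algebra.Module"
begin

definition Spec :: "('a, 'x) ring_scheme \<Rightarrow> 'a set set" where
  "Spec R = {P. primeideal P R}"

definition Max_Spec :: "('a, 'x) ring_scheme \<Rightarrow> 'a set set" where
  "Max_Spec R = {P. maximalideal P R}"

definition gelfand_ring :: "('a, 'x) ring_scheme \<Rightarrow> bool" where
  "gelfand_ring R \<longleftrightarrow> cring R \<and> (\<forall>L\<in>Spec R. \<exists>!P. P \<in> Max_Spec R \<and> L \<subseteq> P)"

definition local_ring :: "('a, 'x) ring_scheme \<Rightarrow> bool" where
  "local_ring A \<longleftrightarrow>
     ring A \<and> carrier A \<noteq> {\<zero>\<^bsub>A\<^esub>} \<and> ideal (carrier A - Units A) A"

text \<open>The library's locale \<^locale>\<open>module\<close> requires commutative scalars and \<^locale>\<open>algebra\<close>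
  requires a commutative algebra; the next two locales drop these requirements.  As in the
  library, the ring multiplication and unit of the record type \<^typ>\<open>('s, 'm) module\<close> are
  ignored when the record is used as a module.\<close>

locale left_module = S?: ring S + M?: abelian_group M
  for S :: "('s, 'x) ring_scheme" (structure) and M :: "('s, 'm, 'y) module_scheme" (structure) +
  assumes lsmult_closed:
      "\<lbrakk>a \<in> carrier S; x \<in> carrier M\<rbrakk> \<Longrightarrow> a \<odot>\<^bsub>M\<^esub> x \<in> carrier M"
    and lsmult_l_distr:
      "\<lbrakk>a \<in> carrier S; b \<in> carrier S; x \<in> carrier M\<rbrakk> \<Longrightarrow>
        (a \<oplus>\<^bsub>S\<^esub> b) \<odot>\<^bsub>M\<^esub> x = a \<odot>\<^bsub>M\<^esub> x \<oplus>\<^bsub>M\<^esub> b \<odot>\<^bsub>M\<^esub> x"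
    and lsmult_r_distr:
      "\<lbrakk>a \<in> carrier S; x \<in> carrier M; y \<in> carrier M\<rbrakk> \<Longrightarrow>
        a \<odot>\<^bsub>M\<^esub> (x \<oplus>\<^bsub>M\<^esub> y) = a \<odot>\<^bsub>M\<^esub> x \<oplus>\<^bsub>M\<^esub> a \<odot>\<^bsub>M\<^esub> y"
    and lsmult_assoc:
      "\<lbrakk>a \<in> carrier S; b \<in> carrier S; x \<in> carrier M\<rbrakk> \<Longrightarrow>
        (a \<otimes>\<^bsub>S\<^esub> b) \<odot>\<^bsub>M\<^esub> x = a \<odot>\<^bsub>M\<^esub> (b \<odot>\<^bsub>M\<^esub> x)"
    and lsmult_one:
      "x \<in> carrier M \<Longrightarrow> \<one>\<^bsub>S\<^esub> \<odot>\<^bsub>M\<^esub> x = x"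

locale unital_algebra = module R S + S?: ring S
  for R :: "('a, 'x) ring_scheme" (structure) and S :: "('a, 's, 'y) module_scheme" (structure) +
  assumes smult_mult_left:
      "\<lbrakk>r \<in> carrier R; x \<in> carrier S; y \<in> carrier S\<rbrakk> \<Longrightarrow>
        (r \<odot>\<^bsub>S\<^esub> x) \<otimes>\<^bsub>S\<^esub> y = r \<odot>\<^bsub>S\<^esub> (x \<otimes>\<^bsub>S\<^esub> y)"
    and smult_mult_right:
      "\<lbrakk>r \<in> carrier R; x \<in> carrier S; y \<in> carrier S\<rbrakk> \<Longrightarrow>
        x \<otimes>\<^bsub>S\<^esub> (r \<odot>\<^bsub>S\<^esub> y) = r \<odot>\<^bsub>S\<^esub> (x \<otimes>\<^bsub>S\<^esub> y)"

definition lmod_hom ::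
    "('s, 'x) ring_scheme \<Rightarrow> ('s, 'm) module \<Rightarrow> ('s, 'n) module \<Rightarrow> ('m \<Rightarrow> 'n) set" where
  "lmod_hom S M N = {f \<in> carrier M \<rightarrow> carrier N.
     (\<forall>x\<in>carrier M. \<forall>y\<in>carrier M. f (x \<oplus>\<^bsub>M\<^esub> y) = f x \<oplus>\<^bsub>N\<^esub> f y) \<and>
     (\<forall>a\<in>carrier S. \<forall>x\<in>carrier M. f (a \<odot>\<^bsub>M\<^esub> x) = a \<odot>\<^bsub>N\<^esub> f x)}"

definition lmod_iso ::
    "('s, 'x) ring_scheme \<Rightarrow> ('s, 'm) module \<Rightarrow> ('s, 'n) module \<Rightarrow> ('m \<Rightarrow> 'n) set" where
  "lmod_iso S M N = {f \<in> lmod_hom S M N. bij_betw f (carrier M) (carrier N)}"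

text \<open>Endomorphisms are taken to be \<^const>\<open>undefined\<close> outside the carrier, so that
  equality of record elements is equality of maps on \<open>M\<close>.\<close>

definition End_ring :: "('s, 'x) ring_scheme \<Rightarrow> ('s, 'm) module \<Rightarrow> ('m \<Rightarrow> 'm) ring" where
  "End_ring S M =
     \<lparr>carrier = lmod_hom S M M \<inter> extensional (carrier M),
      mult = (\<lambda>f g. compose (carrier M) f g),
      one = (\<lambda>x\<in>carrier M. x),
      zero = (\<lambda>x\<in>carrier M. \<zero>\<^bsub>M\<^esub>),
      add = (\<lambda>f g. \<lambda>x\<in>carrier M. f x \<oplus>\<^bsub>M\<^esub> g x)\<rparr>"

definition regular_module :: "('a, 'x) ring_scheme \<Rightarrow> ('a, 'a) module" where
  "regular_module R =
     \<lparr>carrier = carrier R, mult = (\<otimes>\<^bsub>R\<^esub>), one = \<one>\<^bsub>R\<^esub>, zero = \<zero>\<^bsub>R\<^esub>, add = (\<oplus>\<^bsub>R\<^esub>),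
      smult = (\<otimes>\<^bsub>R\<^esub>)\<rparr>"

text \<open>An \<open>S\<close>-module viewed as an \<open>R\<close>-module through the structure map \<open>r \<mapsto> r \<odot> 1\<close>
  of the \<open>R\<close>-algebra \<open>S\<close>.\<close>

definition restrict_scalars :: "('a, 's) module \<Rightarrow> ('s, 'm) module \<Rightarrow> ('a, 'm) module" where
  "restrict_scalars S M =
     \<lparr>carrier = carrier M, mult = mult M, one = one M, zero = zero M, add = add M,
      smult = (\<lambda>r x. (r \<odot>\<^bsub>S\<^esub> \<one>\<^bsub>S\<^esub>) \<odot>\<^bsub>M\<^esub> x)\<rparr>"

text \<open>The fraction \<open>x/s\<close> of the localization at \<open>P\<close> of an \<open>R\<close>-module \<open>N\<close>, as the set of all
  pairs \<open>(y, t)\<close> with \<open>u(t x - s y) = 0\<close> for some \<open>u \<notin> P\<close>.\<close>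

definition fraction ::
    "('a, 'x) ring_scheme \<Rightarrow> 'a set \<Rightarrow> ('a, 'm) module \<Rightarrow> 'm \<Rightarrow> 'a \<Rightarrow> ('m \<times> 'a) set" where
  "fraction R P N x s = {(y, t). y \<in> carrier N \<and> t \<in> carrier R - P \<and>
     (\<exists>u\<in>carrier R - P. u \<odot>\<^bsub>N\<^esub> (t \<odot>\<^bsub>N\<^esub> x) = u \<odot>\<^bsub>N\<^esub> (s \<odot>\<^bsub>N\<^esub> y))}"

text \<open>Operations on fractions are defined by uniting the results over all
  representatives; these results all coincide.\<close>

definition ring_localization ::
    "('a, 'x) ring_scheme \<Rightarrow> 'a set \<Rightarrow> ('a \<times> 'a) set ring" where
  "ring_localization R P = (let fr = fraction R P (regular_module R) in
     \<lparr>carrier = {fr a s | a s. a \<in> carrier R \<and> s \<in> carrier R - P},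
      mult = (\<lambda>U V. \<Union>(a, s)\<in>U. \<Union>(b, t)\<in>V. fr (a \<otimes>\<^bsub>R\<^esub> b) (s \<otimes>\<^bsub>R\<^esub> t)),
      one = fr \<one>\<^bsub>R\<^esub> \<one>\<^bsub>R\<^esub>,
      zero = fr \<zero>\<^bsub>R\<^esub> \<one>\<^bsub>R\<^esub>,
      add = (\<lambda>U V. \<Union>(a, s)\<in>U. \<Union>(b, t)\<in>V.
               fr (t \<otimes>\<^bsub>R\<^esub> a \<oplus>\<^bsub>R\<^esub> s \<otimes>\<^bsub>R\<^esub> b) (s \<otimes>\<^bsub>R\<^esub> t))\<rparr>)"

definition to_ring_localization ::
    "('a, 'x) ring_scheme \<Rightarrow> 'a set \<Rightarrow> 'a \<Rightarrow> ('a \<times> 'a) set" where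
  "to_ring_localization R P a = fraction R P (regular_module R) a \<one>\<^bsub>R\<^esub>"

text \<open>For a left module \<open>M\<close> over the \<open>R\<close>-algebra \<open>S\<close>, the localization \<open>M\<^sub>P\<close> of the
  underlying \<open>R\<close>-module, together with the action \<open>a (x/s) = (a x)/s\<close> of \<open>S\<close> on it.
  For \<open>S = R\<close> this is the usual localization of an \<open>R\<close>-module, as an \<open>R\<close>-module.\<close>

definition module_localization ::
    "('a, 'x) ring_scheme \<Rightarrow> ('a, 's) module \<Rightarrow> 'a set \<Rightarrow> ('s, 'm) module
      \<Rightarrow> ('s, ('m \<times> 'a) set) module" where
  "module_localization R S P M =
     (let N = restrict_scalars S M; fr = fraction R P N in
     \<lparr>carrier = {fr x s | x s. x \<in> carrier M \<and> s \<in> carrier R - P},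
      mult = undefined,
      one = undefined,
      zero = fr \<zero>\<^bsub>M\<^esub> \<one>\<^bsub>R\<^esub>,
      add = (\<lambda>U V. \<Union>(x, s)\<in>U. \<Union>(y, t)\<in>V.
               fr (t \<odot>\<^bsub>N\<^esub> x \<oplus>\<^bsub>M\<^esub> s \<odot>\<^bsub>N\<^esub> y) (s \<otimes>\<^bsub>R\<^esub> t)),
      smult = (\<lambda>a U. \<Union>(x, s)\<in>U. fr (a \<odot>\<^bsub>M\<^esub> x) s)\<rparr>)"

definition to_module_localization ::
    "('a, 'x) ring_scheme \<Rightarrow> ('a, 's) module \<Rightarrow> 'a set \<Rightarrow> ('s, 'm) module
      \<Rightarrow> 'm \<Rightarrow> ('m \<times> 'a) set" where
  "to_module_localization R S P M x = fraction R P (restrict_scalars S M) x \<one>\<^bsub>R\<^esub>"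

definition Supp ::
    "('a, 'x) ring_scheme \<Rightarrow> ('a, 's) module \<Rightarrow> ('s, 'm) module \<Rightarrow> 'a set set" where
  "Supp R S M = {P \<in> Spec R.
     carrier (module_localization R S P M) \<noteq> {\<zero>\<^bsub>module_localization R S P M\<^esub>}}"

text \<open>HOL has no quantification over types inside a formula, so "for each \<open>R\<close>-algebra \<open>S\<close>
  and each left \<open>S\<close>-module \<open>M\<close>" ranges over all structures with carriers in two fixed types,
  which play the role of universes and are universally quantified as type variables of a
  theorem.  For these to be large enough to be meaningful as a universe for \<open>R\<close> when the
  condition is a hypothesis, the carrier of \<open>R\<close> has to embed in them; no such embedding is
  needed when the condition is a conclusion.\<close>

end

theory Submission
  imports Defs "HOL-Algebra.Ring_Divisibility"
begin

text \<open>If \<open>End\<^sub>S(M)\<close> is local, the elements of \<open>R\<close> acting on \<open>M\<close> as non-units form a prime ideal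
  \<open>L\<close>, and everything outside \<open>L\<close> acts bijectively.  So \<open>M = M\<^sub>P\<close> for a maximal \<open>P\<close> above \<open>L\<close>.
  In a Gelfand ring, distinct maximal ideals \<open>P\<close>, \<open>Q\<close> admit \<open>u \<notin> P\<close>, \<open>v \<notin> Q\<close> with \<open>u v = 0\<close>
  (otherwise a prime ideal avoiding all these products lies in both); as \<open>u\<close> acts bijectively,
  \<open>v\<close> kills \<open>M\<close>, whence \<open>M\<^sub>Q = 0\<close>.  The same separation shows that the kernel of
  \<open>R \<rightarrow> R\<^sub>P\<close> and any \<open>s \<notin> P\<close> together generate \<open>R\<close>, which inverts \<open>s\<close> in the image of \<open>R\<close>.
  Conversely, a prime ideal \<open>L\<close> below two maximal ideals yields the module \<open>R\<^sub>L\<close>, whose endomorphism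
  ring is local and whose support contains both.  It fits into the given universes because an
  infinite \<open>R\<close> has as many elements as \<open>R \<times> R\<close>, while every finite ring is Gelfand.\<close>

section \<open>Maximal and prime ideals\<close>

text \<open>Zorn's lemma: the union of a nonempty chain of ideals above \<open>I\<close> and
  disjoint from \<open>T\<close> is again one. The set \<open>T\<close> is left arbitrary because
  \<open>{\<one>}\<close> will give maximal ideals and multiplicative sets will give prime
  ideals.\<close>

lemma (in ring) ex_maximal_ideal_avoiding:
  assumes I: "ideal I R" and disj: "I \<inter> T = {}"
  obtains J where "ideal J R" "I \<subseteq> J" "J \<inter> T = {}"
    "\<And>K. \<lbrakk>ideal K R; J \<subseteq> K; K \<inter> T = {}\<rbrakk> \<Longrightarrow> K = J"
proof -
  let ?A = "{J. ideal J R \<and> I \<subseteq> J \<and> J \<inter> T = {}}"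
  have "\<exists>J\<in>?A. \<forall>K\<in>?A. J \<subseteq> K \<longrightarrow> K = J"
  proof (rule subset_Zorn)
    fix C assume C: "subset.chain ?A C"
    show "\<exists>U\<in>?A. \<forall>K\<in>C. K \<subseteq> U"
    proof (cases "C = {}")
      case True
      with assms show ?thesis by auto
    next
      case False
      have "subset.chain {J. ideal J R} C"
        using C by (auto simp: pred_on.chain_def)
      then have "ideal (\<Union>C) R"
        using chain_Union_is_ideal[of C] False by simp
      moreover have "I \<subseteq> \<Union>C" "\<Union>C \<inter> T = {}"
        using C False unfolding pred_on.chain_def by blast+
      ultimately show ?thesis by auto
    qed
  qed
  then obtain J where J: "J \<in> ?A" "\<forall>K\<in>?A. J \<subseteq> K \<longrightarrow> K = J"
    by (rule bexE)
  show thesis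
  proof (rule that)
    fix K assume K: "ideal K R" "J \<subseteq> K" "K \<inter> T = {}"
    then have "K \<in> ?A" using J(1) by auto
    then show "K = J" using J(2) K(2) by blast
  qed (use J(1) in auto)
qed

text \<open>An ideal is proper exactly when it misses \<open>\<one>\<close>, so an ideal that is
  largest among those disjoint from \<open>{\<one>}\<close> is maximal.\<close>

lemma (in ring) ex_maximalideal:
  assumes I: "ideal I R" and ne: "I \<noteq> carrier R"
  obtains P where "maximalideal P R" "I \<subseteq> P"
proof -
  have one: "\<one> \<notin> J \<longleftrightarrow> J \<noteq> carrier R" if "ideal J R" for J
    using ideal.one_imp_carrier[OF that] by auto
  have disj: "I \<inter> {\<one>} = {}"
    using one[OF I] ne by simp
  obtain J where J: "ideal J R" "I \<subseteq> J" "J \<inter> {\<one>} = {}"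
    "\<And>K. \<lbrakk>ideal K R; J \<subseteq> K; K \<inter> {\<one>} = {}\<rbrakk> \<Longrightarrow> K = J"
    using ex_maximal_ideal_avoiding[OF I disj] by blast
  have "maximalideal J R"
  proof (rule maximalidealI)
    show "carrier R \<noteq> J"
      using J(3) by auto
    show "K = J \<or> K = carrier R" if "ideal K R" "J \<subseteq> K" "K \<subseteq> carrier R" for K
      using J(4)[of K] one[of K] that by auto
  qed (fact J(1))
  then show thesis
    using that J(2) by blast
qed

text \<open>An ideal \<open>J\<close> that is largest among those missing the multiplicative set
  \<open>T\<close> is prime. If \<open>a\<close> and \<open>b\<close> lie outside \<open>J\<close>,
  then \<open>J + Ra\<close> and \<open>J + Rb\<close> both meet \<open>T\<close>. The product of
  the two elements found lies in \<open>T\<close>, but it would lie in \<open>J\<close> if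
  \<open>a \<otimes> b\<close> did.\<close>

lemma (in cring) ex_primeideal_avoiding:
  assumes I: "ideal I R" and disj: "I \<inter> T = {}" and T: "T \<subseteq> carrier R" "\<one> \<in> T"
    and T_mult: "\<And>a b. \<lbrakk>a \<in> T; b \<in> T\<rbrakk> \<Longrightarrow> a \<otimes> b \<in> T"
  obtains P where "primeideal P R" "I \<subseteq> P" "P \<inter> T = {}"
proof -
  obtain J where J: "ideal J R" "I \<subseteq> J" "J \<inter> T = {}"
    and max: "\<And>K. \<lbrakk>ideal K R; J \<subseteq> K; K \<inter> T = {}\<rbrakk> \<Longrightarrow> K = J"
    using ex_maximal_ideal_avoiding[OF I disj] by blast
  interpret J: ideal J R by fact
  have meets: "\<exists>j\<in>J. \<exists>r\<in>carrier R. j \<oplus> r \<otimes> a \<in> T" if a: "a \<in> carrier R" "a \<notin> J" for a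
  proof -
    let ?K = "J <+>\<^bsub>R\<^esub> PIdl a"
    have K: "ideal ?K R"
      by (intro add_ideals J(1) cgenideal_ideal a)
    have mem: "j \<oplus> r \<otimes> a \<in> ?K" if "j \<in> J" "r \<in> carrier R" for j r
      using that unfolding set_add_def' cgenideal_def by blast
    have "J \<subseteq> ?K"
    proof
      fix j assume "j \<in> J"
      then show "j \<in> ?K"
        using mem[of j \<zero>] J.Icarr[of j] a(1) by simp
    qed
    moreover have "a \<in> ?K"
      using mem[of \<zero> \<one>] a(1) by simp
    ultimately have "?K \<inter> T \<noteq> {}"
      using max[OF K] a(2) by auto
    then show ?thesis
      unfolding set_add_def' cgenideal_def by blast
  qed
  have "primeideal J R"
  proof (rule primeidealI)
    show "carrier R \<noteq> J"
      using T(2) J(3) by auto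
    fix a b assume ab: "a \<in> carrier R" "b \<in> carrier R" "a \<otimes> b \<in> J"
    show "a \<in> J \<or> b \<in> J"
    proof (rule ccontr)
      assume "\<not> (a \<in> J \<or> b \<in> J)"
      then obtain i r j s where ir: "i \<in> J" "r \<in> carrier R" "i \<oplus> r \<otimes> a \<in> T"
        and js: "j \<in> J" "s \<in> carrier R" "j \<oplus> s \<otimes> b \<in> T"
        using meets ab by meson
      \<comment> \<open>Every term of the expansion has a factor in \<open>J\<close>: either
        \<open>i\<close>, or \<open>j\<close>, or \<open>a \<otimes> b\<close>.\<close>
      have "(i \<oplus> r \<otimes> a) \<otimes> (j \<oplus> s \<otimes> b)
          = i \<otimes> (j \<oplus> s \<otimes> b) \<oplus> (r \<otimes> a \<otimes> j \<oplus> r \<otimes> s \<otimes> (a \<otimes> b))"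
        using ir(1,2) js(1,2) ab J.Icarr by (simp add: l_distr r_distr m_ac a_ac)
      also have "\<dots> \<in> J"
        using ir js ab J.Icarr by (simp add: J.I_l_closed J.I_r_closed)
      finally show False
        using T_mult[OF ir(3) js(3)] J(3) by auto
    qed
  qed (fact J(1), rule is_cring)
  then show thesis
    using that J by blast
qed

section \<open>Complements of prime ideals, and Gelfand rings\<close>

lemma (in primeideal) one_compl: "\<one> \<in> carrier R - I"
  using one_imp_carrier I_notcarr by auto

lemma (in primeideal) mult_compl:
  "\<lbrakk>a \<in> carrier R - I; b \<in> carrier R - I\<rbrakk> \<Longrightarrow> a \<otimes> b \<in> carrier R - I"
  using I_prime by auto

text \<open>A prime ideal is proper, so a maximal ideal above it always exists; only uniqueness
  carries content.\<close>

lemma (in cring) gelfand_ring_iff: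
  "gelfand_ring R \<longleftrightarrow>
    (\<forall>L P Q. primeideal L R \<and> maximalideal P R \<and> maximalideal Q R \<and> L \<subseteq> P \<and> L \<subseteq> Q \<longrightarrow> P = Q)"
proof -
  have ex: "\<exists>P. maximalideal P R \<and> L \<subseteq> P" if L: "primeideal L R" for L
    using ex_maximalideal[OF primeideal.axioms(1)[OF L]] primeideal.I_notcarr[OF L] by metis
  have "gelfand_ring R \<longleftrightarrow> (\<forall>L. primeideal L R \<longrightarrow> (\<exists>!P. maximalideal P R \<and> L \<subseteq> P))"
    using is_cring by (simp add: gelfand_ring_def Spec_def Max_Spec_def)
  also have "\<dots> \<longleftrightarrow> (\<forall>L. primeideal L R \<longrightarrow>
      (\<forall>P Q. maximalideal P R \<and> L \<subseteq> P \<and> maximalideal Q R \<and> L \<subseteq> Q \<longrightarrow> P = Q))"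
    using ex by metis
  finally show ?thesis by metis
qed

text \<open>If no such product vanished, the products \<open>u \<otimes> v\<close> would form a
  multiplicative set \<open>T\<close> without zero, and some prime \<open>L\<close> would avoid
  \<open>T\<close>. Setting one factor to \<open>\<one>\<close> shows that \<open>T\<close> contains
  the complements of both \<open>P\<close> and \<open>Q\<close>, so \<open>L\<close> would lie below
  two distinct maximal ideals.\<close>

lemma (in cring) gelfand_separation:
  assumes "gelfand_ring R" and P: "maximalideal P R" and Q: "maximalideal Q R" and "P \<noteq> Q"
  obtains u v where "u \<in> carrier R - P" "v \<in> carrier R - Q" "u \<otimes> v = \<zero>"
proof (rule ccontr)
  interpret P: primeideal P R by (rule maximalideal_prime[OF P])
  interpret Q: primeideal Q R by (rule maximalideal_prime[OF Q])
  assume "\<not> thesis"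
  then have nz: "u \<otimes> v \<noteq> \<zero>" if "u \<in> carrier R - P" "v \<in> carrier R - Q" for u v
    using that \<open>\<And>v u. \<lbrakk>u \<in> carrier R - P; v \<in> carrier R - Q; u \<otimes> v = \<zero>\<rbrakk> \<Longrightarrow> thesis\<close> by blast
  define T where "T = {u \<otimes> v | u v. u \<in> carrier R - P \<and> v \<in> carrier R - Q}"
  have in_T: "u \<otimes> v \<in> T" if "u \<in> carrier R - P" "v \<in> carrier R - Q" for u v
    unfolding T_def using that by blast
  have T1: "\<one> \<in> T"
    using in_T[OF P.one_compl Q.one_compl] by simp
  have disj: "{\<zero>} \<inter> T = {}"
    using nz unfolding T_def by fastforce
  have TT: "a \<otimes> b \<in> T" if ab: "a \<in> T" "b \<in> T" for a b
  proof -
    obtain u v u' v' where "a = u \<otimes> v" "b = u' \<otimes> v'"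
      and c: "u \<in> carrier R - P" "u' \<in> carrier R - P" "v \<in> carrier R - Q" "v' \<in> carrier R - Q"
      using ab unfolding T_def by blast
    then have "a \<otimes> b = (u \<otimes> u') \<otimes> (v \<otimes> v')"
      by (auto simp: m_ac)
    then show ?thesis
      using in_T[OF P.mult_compl Q.mult_compl] c by auto
  qed
  obtain L where L: "primeideal L R" "L \<inter> T = {}"
    by (rule ex_primeideal_avoiding[OF zeroideal disj _ T1 TT]) (auto simp: T_def)
  have "x \<in> P" "x \<in> Q" if "x \<in> L" for x
    using in_T[of x \<one>] in_T[of \<one> x] P.one_compl Q.one_compl L that
      ideal.Icarr[OF primeideal.axioms(1)[OF L(1)] that] by auto
  then have "P = Q"
    using gelfand_ring_iff assms L by blast
  with \<open>P \<noteq> Q\<close> show False ..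
qed

text \<open>In a finite ring every prime ideal is maximal. The powers of \<open>a\<close> repeat, so
  \<open>a^m (1 - a^(k+1)) = 0\<close> for some \<open>m\<close> and \<open>k\<close>. If
  \<open>a\<close> were in \<open>P\<close> but not in the prime \<open>L\<close> below
  \<open>P\<close>, then \<open>1 - a^(k+1)\<close> would be in \<open>L\<close>, hence in
  \<open>P\<close>, and \<open>P\<close> would contain \<open>\<one>\<close>.\<close>

lemma (in cring) gelfand_ring_if_finite:
  assumes "finite (carrier R)"
  shows "gelfand_ring R"
proof -
  have "P \<subseteq> L" if L: "primeideal L R" and P: "maximalideal P R" "L \<subseteq> P" for L P
  proof
    interpret L: primeideal L R by fact
    interpret P: primeideal P R by (rule maximalideal_prime[OF P(1)])
    fix a assume a: "a \<in> P"
    then have a': "a \<in> carrier R" by (rule P.Icarr)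
    show "a \<in> L"
    proof (rule ccontr)
      assume "a \<notin> L"
      have pow: "a [^] n \<in> carrier R - L" for n :: nat
        by (induction n) (use L.one_compl L.mult_compl a' \<open>a \<notin> L\<close> in auto)
      have "\<not> inj (\<lambda>n::nat. a [^] n)"
        using assms a' by (metis finite_imageD finite_subset image_subsetI infinite_UNIV_nat nat_pow_closed)
      then obtain m n :: nat where "m < n" "a [^] m = a [^] n"
        unfolding inj_def by (metis linorder_neqE_nat)
      \<comment> \<open>The exponent is \<open>n - m\<close>, written as \<open>Suc k\<close>
        because it must be positive for this power of \<open>a\<close> to lie in
        \<open>P\<close>.\<close>
      then obtain k where "a [^] m = a [^] m \<otimes> a [^] Suc k"
        using a' by (metis less_imp_Suc_add add_Suc_right nat_pow_mult)
      then have "a [^] m \<otimes> (\<one> \<ominus> a [^] Suc k) = \<zero>"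
        using a' by (simp add: r_distr a_minus_def r_minus r_neg del: nat_pow_Suc)
      then have "\<one> \<ominus> a [^] Suc k \<in> L"
        using pow[of m] L.I_prime[of "a [^] m" "\<one> \<ominus> a [^] Suc k"] a' L.zero_closed by auto
      then have "\<one> \<ominus> a [^] Suc k \<in> P" "a [^] Suc k \<in> P"
        using P(2) a a' P.I_l_closed by auto
      then have "(\<one> \<ominus> a [^] Suc k) \<oplus> a [^] Suc k \<in> P"
        by (rule P.a_closed)
      then show False
        using P.one_compl a' by (simp add: a_minus_def a_assoc l_neg del: nat_pow_Suc)
    qed
  qed
  then show ?thesis
    unfolding gelfand_ring_iff by blast
qed

section \<open>Localization of modules\<close>

locale prime_localization = Module.module R N + primeideal P R
  for R :: "('a, 'x) ring_scheme" (structure) and N :: "('a, 'm) module" (structure) and P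
begin

lemma mem_fraction:
  "(y, t) \<in> fraction R P N x s \<longleftrightarrow> y \<in> carrier N \<and> t \<in> carrier R - P \<and>
    (\<exists>u\<in>carrier R - P. u \<odot>\<^bsub>N\<^esub> (t \<odot>\<^bsub>N\<^esub> x) = u \<odot>\<^bsub>N\<^esub> (s \<odot>\<^bsub>N\<^esub> y))"
  by (simp add: fraction_def)

lemma fraction_self: "\<lbrakk>x \<in> carrier N; s \<in> carrier R - P\<rbrakk> \<Longrightarrow> (x, s) \<in> fraction R P N x s"
  using one_compl by (auto simp: mem_fraction)

text \<open>This is transitivity of the equivalence of pairs. If \<open>u\<close> witnesses
  \<open>x/s = y/t\<close> and \<open>v\<close> witnesses \<open>x/s = z/w\<close>, then
  \<open>u \<otimes> v \<otimes> s\<close> witnesses \<open>y/t = z/w\<close>.\<close>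

lemma fraction_subset:
  assumes xy: "x \<in> carrier N" "y \<in> carrier N" and st: "s \<in> carrier R - P" "t \<in> carrier R - P"
    and u: "u \<in> carrier R - P" and eq: "u \<odot>\<^bsub>N\<^esub> (t \<odot>\<^bsub>N\<^esub> x) = u \<odot>\<^bsub>N\<^esub> (s \<odot>\<^bsub>N\<^esub> y)"
  shows "fraction R P N x s \<subseteq> fraction R P N y t"
proof (rule subrelI)
  fix z w assume "(z, w) \<in> fraction R P N x s"
  then obtain v where zw: "z \<in> carrier N" "w \<in> carrier R - P" and v: "v \<in> carrier R - P"
    and eq': "v \<odot>\<^bsub>N\<^esub> (w \<odot>\<^bsub>N\<^esub> x) = v \<odot>\<^bsub>N\<^esub> (s \<odot>\<^bsub>N\<^esub> z)"
    by (auto simp: mem_fraction)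
  note [simp] = xy zw(1) and c = st zw(2) u v
  have "(u \<otimes> v \<otimes> s) \<odot>\<^bsub>N\<^esub> (w \<odot>\<^bsub>N\<^esub> y) = (v \<otimes> w) \<odot>\<^bsub>N\<^esub> (u \<odot>\<^bsub>N\<^esub> (s \<odot>\<^bsub>N\<^esub> y))"
    using c by (simp add: smult_assoc1[symmetric] m_ac)
  also have "\<dots> = (u \<otimes> t) \<odot>\<^bsub>N\<^esub> (v \<odot>\<^bsub>N\<^esub> (w \<odot>\<^bsub>N\<^esub> x))"
    unfolding eq[symmetric] using c by (simp add: smult_assoc1[symmetric] m_ac)
  also have "\<dots> = (u \<otimes> v \<otimes> s) \<odot>\<^bsub>N\<^esub> (t \<odot>\<^bsub>N\<^esub> z)"
    unfolding eq' using c by (simp add: smult_assoc1[symmetric] m_ac)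
  finally show "(z, w) \<in> fraction R P N y t"
    using zw mult_compl[OF mult_compl[OF u v] st(1)] by (auto simp: mem_fraction)
qed

text \<open>Each fraction contains the pair that names it, so equal sets give the cross-multiplied
  equation. Conversely that equation is symmetric in the two pairs, so it yields both
  inclusions.\<close>

lemma fraction_eq_iff:
  assumes "x \<in> carrier N" "y \<in> carrier N" "s \<in> carrier R - P" "t \<in> carrier R - P"
  shows "fraction R P N x s = fraction R P N y t \<longleftrightarrow>
    (\<exists>u\<in>carrier R - P. u \<odot>\<^bsub>N\<^esub> (t \<odot>\<^bsub>N\<^esub> x) = u \<odot>\<^bsub>N\<^esub> (s \<odot>\<^bsub>N\<^esub> y))"
  (is "?l = ?r \<longleftrightarrow> ?ex")
proof
  assume "?l = ?r"
  with fraction_self[of y t] assms have "(y, t) \<in> ?l" by simp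
  then show ?ex by (simp add: mem_fraction)
next
  assume ?ex
  with assms show "?l = ?r"
    by (metis fraction_subset subset_antisym)
qed

lemma fraction_eqI:
  assumes "t \<odot>\<^bsub>N\<^esub> x = s \<odot>\<^bsub>N\<^esub> y"
    and "x \<in> carrier N" "y \<in> carrier N" "s \<in> carrier R - P" "t \<in> carrier R - P"
  shows "fraction R P N x s = fraction R P N y t"
  using assms one_compl by (auto simp: fraction_eq_iff)

text \<open>Independence of the sum from the representatives: the product of the two witnesses is a
  witness for the sums. This makes the unions in the definition of addition unions of constant
  families.\<close>

lemma fraction_add_cong:
  assumes "x \<in> carrier N" "y \<in> carrier N" "s \<in> carrier R - P" "t \<in> carrier R - P"
    and "(x', s') \<in> fraction R P N x s" "(y', t') \<in> fraction R P N y t"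
  shows "fraction R P N (t' \<odot>\<^bsub>N\<^esub> x' \<oplus>\<^bsub>N\<^esub> s' \<odot>\<^bsub>N\<^esub> y') (s' \<otimes> t')
    = fraction R P N (t \<odot>\<^bsub>N\<^esub> x \<oplus>\<^bsub>N\<^esub> s \<odot>\<^bsub>N\<^esub> y) (s \<otimes> t)"
proof -
  obtain u v where c: "x' \<in> carrier N" "y' \<in> carrier N" "s' \<in> carrier R - P" "t' \<in> carrier R - P"
      "u \<in> carrier R - P" "v \<in> carrier R - P"
    and eq: "u \<odot>\<^bsub>N\<^esub> (s' \<odot>\<^bsub>N\<^esub> x) = u \<odot>\<^bsub>N\<^esub> (s \<odot>\<^bsub>N\<^esub> x')"
      "v \<odot>\<^bsub>N\<^esub> (t' \<odot>\<^bsub>N\<^esub> y) = v \<odot>\<^bsub>N\<^esub> (t \<odot>\<^bsub>N\<^esub> y')"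
    using assms(5,6) by (auto simp: mem_fraction)
  note c = c assms(1-4)
  have "(u \<otimes> v) \<odot>\<^bsub>N\<^esub> ((s \<otimes> t) \<odot>\<^bsub>N\<^esub> (t' \<odot>\<^bsub>N\<^esub> x' \<oplus>\<^bsub>N\<^esub> s' \<odot>\<^bsub>N\<^esub> y'))
      = (v \<otimes> t \<otimes> t') \<odot>\<^bsub>N\<^esub> (u \<odot>\<^bsub>N\<^esub> (s \<odot>\<^bsub>N\<^esub> x')) \<oplus>\<^bsub>N\<^esub> (u \<otimes> s \<otimes> s') \<odot>\<^bsub>N\<^esub> (v \<odot>\<^bsub>N\<^esub> (t \<odot>\<^bsub>N\<^esub> y'))"
    using c by (simp add: smult_r_distr smult_assoc1[symmetric] m_ac)
  also have "\<dots> = (u \<otimes> v) \<odot>\<^bsub>N\<^esub> ((s' \<otimes> t') \<odot>\<^bsub>N\<^esub> (t \<odot>\<^bsub>N\<^esub> x \<oplus>\<^bsub>N\<^esub> s \<odot>\<^bsub>N\<^esub> y))"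
    unfolding eq[symmetric] using c by (simp add: smult_r_distr smult_assoc1[symmetric] m_ac)
  finally show ?thesis
    using c mult_compl by (subst fraction_eq_iff) auto
qed

end

section \<open>Modules over an \<open>R\<close>-algebra, viewed as \<open>R\<close>-modules\<close>

lemma restrict_scalars_simps [simp]:
  "carrier (restrict_scalars S M) = carrier M"
  "add (restrict_scalars S M) = add M"
  "zero (restrict_scalars S M) = zero M"
  by (simp_all add: restrict_scalars_def)

lemma a_inv_restrict_scalars [simp]: "a_inv (restrict_scalars S M) = a_inv M"
  by (simp add: a_inv_def fun_eq_iff m_inv_def)

lemma smult_restrict_scalars:
  "r \<odot>\<^bsub>restrict_scalars S M\<^esub> x = (r \<odot>\<^bsub>S\<^esub> \<one>\<^bsub>S\<^esub>) \<odot>\<^bsub>M\<^esub> x"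
  by (simp add: restrict_scalars_def)

locale algebra_module = A?: unital_algebra R S + L?: left_module S M
  for R :: "('a, 'x) ring_scheme" (structure) and S :: "('a, 's) module" (structure)
    and M :: "('s, 'm) module" (structure)
begin

abbreviation N where "N \<equiv> restrict_scalars S M"

text \<open>The rewrites phrase the inherited facts in terms of the group \<open>M\<close> itself,
  so that \<open>N\<close> survives only in the action of \<open>R\<close>.\<close>

sublocale N: Module.module R N
  rewrites "carrier N = carrier M" and "add N = add M" and "zero N = zero M"
    and "a_inv N = a_inv M"
proof -
  show "Module.module R N"
  proof (rule moduleI)
    show "abelian_group N"
      by (rule abelian_groupI) (auto simp: M.a_ac intro: M.l_neg)
    fix a b x assume ab: "a \<in> carrier R" "b \<in> carrier R" and x: "x \<in> carrier N"
    have "(a \<otimes> b) \<odot>\<^bsub>S\<^esub> \<one>\<^bsub>S\<^esub> = (a \<odot>\<^bsub>S\<^esub> \<one>\<^bsub>S\<^esub>) \<otimes>\<^bsub>S\<^esub> (b \<odot>\<^bsub>S\<^esub> \<one>\<^bsub>S\<^esub>)"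
      using ab by (simp add: smult_mult_left smult_assoc1)
    then show "(a \<otimes> b) \<odot>\<^bsub>N\<^esub> x = a \<odot>\<^bsub>N\<^esub> (b \<odot>\<^bsub>N\<^esub> x)"
      using ab x by (simp add: smult_restrict_scalars lsmult_assoc)
    show "(a \<oplus> b) \<odot>\<^bsub>N\<^esub> x = a \<odot>\<^bsub>N\<^esub> x \<oplus>\<^bsub>N\<^esub> b \<odot>\<^bsub>N\<^esub> x"
      using ab x by (simp add: smult_restrict_scalars smult_l_distr lsmult_l_distr)
  qed (simp_all add: smult_restrict_scalars lsmult_closed lsmult_r_distr lsmult_one is_cring)
qed simp_all

text \<open>The structure map \<open>r \<mapsto> r \<odot> 1\<close> sends \<open>R\<close> into the
  center of \<open>S\<close>.\<close>

lemma smult_restrict_commute: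
  assumes "a \<in> carrier S" "r \<in> carrier R" "x \<in> carrier M"
  shows "a \<odot>\<^bsub>M\<^esub> (r \<odot>\<^bsub>N\<^esub> x) = r \<odot>\<^bsub>N\<^esub> (a \<odot>\<^bsub>M\<^esub> x)"
proof -
  have "a \<otimes>\<^bsub>S\<^esub> (r \<odot>\<^bsub>S\<^esub> \<one>\<^bsub>S\<^esub>) = (r \<odot>\<^bsub>S\<^esub> \<one>\<^bsub>S\<^esub>) \<otimes>\<^bsub>S\<^esub> a"
    using assms by (simp add: smult_mult_left smult_mult_right)
  then show ?thesis
    using assms by (simp add: smult_restrict_scalars flip: lsmult_assoc)
qed

end

section \<open>Localization of an \<open>S\<close>-module at a prime ideal of
  \<open>R\<close>\<close>

locale algebra_module_prime = algebra_module R S M + primeideal P R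
  for R :: "('a, 'x) ring_scheme" (structure) and S :: "('a, 's) module" (structure)
    and M :: "('s, 'm) module" (structure) and P
begin

sublocale N: prime_localization R N P
  rewrites "carrier N = carrier M" and "add N = add M" and "zero N = zero M"
    and "a_inv N = a_inv M"
  by (intro prime_localization.intro N.module_axioms primeideal_axioms
      | use N.module_axioms in simp)+

abbreviation fr where "fr \<equiv> fraction R P N"
abbreviation M\<^sub>P where "M\<^sub>P \<equiv> module_localization R S P M"

lemma carrier_localization: "carrier M\<^sub>P = {fr x s | x s. x \<in> carrier M \<and> s \<in> carrier R - P}"
  and zero_localization: "\<zero>\<^bsub>M\<^sub>P\<^esub> = fr \<zero>\<^bsub>M\<^esub> \<one>"
  by (simp_all add: module_localization_def Let_def)

lemma fr_closed: "\<lbrakk>x \<in> carrier M; s \<in> carrier R - P\<rbrakk> \<Longrightarrow> fr x s \<in> carrier M\<^sub>P"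
  unfolding carrier_localization by blast

lemma fr_cases:
  assumes "X \<in> carrier M\<^sub>P"
  obtains x s where "x \<in> carrier M" "s \<in> carrier R - P" "X = fr x s"
  using assms unfolding carrier_localization by blast

text \<open>Both unions range over nonempty families whose members all coincide, so each collapses
  to its value at the named representative.\<close>

lemma fr_add:
  assumes "x \<in> carrier M" "y \<in> carrier M" "s \<in> carrier R - P" "t \<in> carrier R - P"
  shows "fr x s \<oplus>\<^bsub>M\<^sub>P\<^esub> fr y t = fr (t \<odot>\<^bsub>N\<^esub> x \<oplus>\<^bsub>M\<^esub> s \<odot>\<^bsub>N\<^esub> y) (s \<otimes> t)"
    (is "_ = ?c")
proof -
  let ?f = "\<lambda>x' s' y' t'. fr (t' \<odot>\<^bsub>N\<^esub> x' \<oplus>\<^bsub>M\<^esub> s' \<odot>\<^bsub>N\<^esub> y') (s' \<otimes> t')"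
  have inner: "(\<Union>(y', t')\<in>fr y t. ?f x' s' y' t') = ?c" if "(x', s') \<in> fr x s" for x' s'
  proof (rule UN_constant_eq)
    show "(y, t) \<in> fr y t"
      using assms by (intro N.fraction_self)
    show "\<forall>p\<in>fr y t. (case p of (y', t') \<Rightarrow> ?f x' s' y' t') = ?c"
      using N.fraction_add_cong[OF assms that] by auto
  qed
  have "(\<Union>(x', s')\<in>fr x s. \<Union>(y', t')\<in>fr y t. ?f x' s' y' t') = ?c"
  proof (rule UN_constant_eq)
    show "(x, s) \<in> fr x s"
      using assms by (intro N.fraction_self)
    show "\<forall>p\<in>fr x s. (case p of (x', s') \<Rightarrow> \<Union>(y', t')\<in>fr y t. ?f x' s' y' t') = ?c"
      using inner by auto
  qed
  then show ?thesis
    by (simp add: module_localization_def Let_def)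
qed

text \<open>A witness for \<open>x'/s' = x/s\<close> remains one after applying \<open>a\<close>,
  because \<open>a\<close> commutes with the action of \<open>R\<close>.\<close>

lemma fr_smult:
  assumes a: "a \<in> carrier S" and xs: "x \<in> carrier M" "s \<in> carrier R - P"
  shows "a \<odot>\<^bsub>M\<^sub>P\<^esub> fr x s = fr (a \<odot>\<^bsub>M\<^esub> x) s"
proof -
  have "fr (a \<odot>\<^bsub>M\<^esub> x') s' = fr (a \<odot>\<^bsub>M\<^esub> x) s" if mem: "(x', s') \<in> fr x s" for x' s'
  proof -
    obtain u where u: "x' \<in> carrier M" "s' \<in> carrier R - P" "u \<in> carrier R - P"
      and eq: "u \<odot>\<^bsub>N\<^esub> (s' \<odot>\<^bsub>N\<^esub> x) = u \<odot>\<^bsub>N\<^esub> (s \<odot>\<^bsub>N\<^esub> x')"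
      using mem by (auto simp: N.mem_fraction)
    have "u \<odot>\<^bsub>N\<^esub> (s \<odot>\<^bsub>N\<^esub> (a \<odot>\<^bsub>M\<^esub> x')) = a \<odot>\<^bsub>M\<^esub> (u \<odot>\<^bsub>N\<^esub> (s \<odot>\<^bsub>N\<^esub> x'))"
      using a xs u by (simp add: smult_restrict_commute lsmult_closed)
    also have "\<dots> = u \<odot>\<^bsub>N\<^esub> (s' \<odot>\<^bsub>N\<^esub> (a \<odot>\<^bsub>M\<^esub> x))"
      unfolding eq[symmetric] using a xs u by (simp add: smult_restrict_commute lsmult_closed)
    finally show ?thesis
      using a xs u by (subst N.fraction_eq_iff) (auto simp: lsmult_closed)
  qed
  then have "\<forall>p\<in>fr x s. (case p of (x', s') \<Rightarrow> fr (a \<odot>\<^bsub>M\<^esub> x') s') = fr (a \<odot>\<^bsub>M\<^esub> x) s"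
    by auto
  then have "(\<Union>(x', s')\<in>fr x s. fr (a \<odot>\<^bsub>M\<^esub> x') s') = fr (a \<odot>\<^bsub>M\<^esub> x) s"
    by (rule UN_constant_eq[OF N.fraction_self[OF xs]])
  then show ?thesis
    by (simp add: module_localization_def Let_def)
qed

lemma left_module_localization: "left_module S M\<^sub>P"
proof -
  note simps = N.smult_r_distr N.smult_assoc1[symmetric] m_ac M.a_ac lsmult_closed
    fr_add fr_smult mult_compl one_compl[simplified]
  have "abelian_group M\<^sub>P"
  proof (rule abelian_groupI)
    fix X Y Z assume "X \<in> carrier M\<^sub>P" "Y \<in> carrier M\<^sub>P" "Z \<in> carrier M\<^sub>P"
    then obtain x y z s t w where c: "x \<in> carrier M" "y \<in> carrier M" "z \<in> carrier M"
        "s \<in> carrier R - P" "t \<in> carrier R - P" "w \<in> carrier R - P"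
      and [simp]: "X = fr x s" "Y = fr y t" "Z = fr z w"
      by (metis fr_cases)
    note c = c mult_compl[OF c(4) c(5)] mult_compl[OF c(5) c(6)]
    show "X \<oplus>\<^bsub>M\<^sub>P\<^esub> Y \<in> carrier M\<^sub>P"
      using c by (auto simp: fr_add intro!: fr_closed)
    show "X \<oplus>\<^bsub>M\<^sub>P\<^esub> Y = Y \<oplus>\<^bsub>M\<^sub>P\<^esub> X"
      using c by (simp add: simps)
    show "X \<oplus>\<^bsub>M\<^sub>P\<^esub> Y \<oplus>\<^bsub>M\<^sub>P\<^esub> Z = X \<oplus>\<^bsub>M\<^sub>P\<^esub> (Y \<oplus>\<^bsub>M\<^sub>P\<^esub> Z)"
      using c by (simp add: simps)
    show "\<zero>\<^bsub>M\<^sub>P\<^esub> \<oplus>\<^bsub>M\<^sub>P\<^esub> X = X"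
      using c one_compl by (simp add: zero_localization fr_add)
    have "fr (\<ominus>\<^bsub>M\<^esub> x) s \<oplus>\<^bsub>M\<^sub>P\<^esub> X = fr (s \<odot>\<^bsub>N\<^esub> (\<ominus>\<^bsub>M\<^esub> x \<oplus>\<^bsub>M\<^esub> x)) (s \<otimes> s)"
      using c by (simp add: fr_add N.smult_r_distr)
    also have "\<dots> = \<zero>\<^bsub>M\<^sub>P\<^esub>"
      unfolding zero_localization using c one_compl mult_compl[OF c(4) c(4)]
      by (intro N.fraction_eqI) (auto simp: M.l_neg)
    finally show "\<exists>Y\<in>carrier M\<^sub>P. Y \<oplus>\<^bsub>M\<^sub>P\<^esub> X = \<zero>\<^bsub>M\<^sub>P\<^esub>"
      using c by (blast intro: fr_closed M.a_inv_closed)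
  qed (use one_compl in \<open>auto simp: zero_localization intro!: fr_closed\<close>)
  moreover have "left_module_axioms S M\<^sub>P"
  proof
    fix a b X Y assume ab: "a \<in> carrier S" "b \<in> carrier S" "X \<in> carrier M\<^sub>P" "Y \<in> carrier M\<^sub>P"
    then obtain x y s t where c: "x \<in> carrier M" "y \<in> carrier M"
        "s \<in> carrier R - P" "t \<in> carrier R - P"
      and [simp]: "X = fr x s" "Y = fr y t"
      by (metis fr_cases)
    note c = c ab(1,2) mult_compl[OF c(3) c(4)]
    show "a \<odot>\<^bsub>M\<^sub>P\<^esub> X \<in> carrier M\<^sub>P"
      using c by (auto simp: fr_smult intro!: fr_closed lsmult_closed)
    show "a \<odot>\<^bsub>M\<^sub>P\<^esub> (X \<oplus>\<^bsub>M\<^sub>P\<^esub> Y) = a \<odot>\<^bsub>M\<^sub>P\<^esub> X \<oplus>\<^bsub>M\<^sub>P\<^esub> a \<odot>\<^bsub>M\<^sub>P\<^esub> Y"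
      using c by (simp add: fr_add fr_smult lsmult_closed lsmult_r_distr smult_restrict_commute)
    show "(a \<otimes>\<^bsub>S\<^esub> b) \<odot>\<^bsub>M\<^sub>P\<^esub> X = a \<odot>\<^bsub>M\<^sub>P\<^esub> (b \<odot>\<^bsub>M\<^sub>P\<^esub> X)"
      using c by (simp add: fr_smult lsmult_closed lsmult_assoc)
    have "(a \<oplus>\<^bsub>S\<^esub> b) \<odot>\<^bsub>M\<^sub>P\<^esub> X = fr (a \<odot>\<^bsub>M\<^esub> x \<oplus>\<^bsub>M\<^esub> b \<odot>\<^bsub>M\<^esub> x) s"
      using c by (simp add: fr_smult lsmult_l_distr)
    \<comment> \<open>The fraction is expanded by \<open>s\<close>, since adding two fractions over
      \<open>s\<close> produces the denominator \<open>s \<otimes> s\<close>.\<close>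
    also have "\<dots> = fr (s \<odot>\<^bsub>N\<^esub> (a \<odot>\<^bsub>M\<^esub> x) \<oplus>\<^bsub>M\<^esub> s \<odot>\<^bsub>N\<^esub> (b \<odot>\<^bsub>M\<^esub> x)) (s \<otimes> s)"
      using c mult_compl[OF c(3) c(3)]
      by (intro N.fraction_eqI) (auto simp: lsmult_closed N.smult_r_distr N.smult_assoc1)
    also have "\<dots> = a \<odot>\<^bsub>M\<^sub>P\<^esub> X \<oplus>\<^bsub>M\<^sub>P\<^esub> b \<odot>\<^bsub>M\<^sub>P\<^esub> X"
      using c by (simp add: fr_add fr_smult lsmult_closed)
    finally show "(a \<oplus>\<^bsub>S\<^esub> b) \<odot>\<^bsub>M\<^sub>P\<^esub> X = a \<odot>\<^bsub>M\<^sub>P\<^esub> X \<oplus>\<^bsub>M\<^sub>P\<^esub> b \<odot>\<^bsub>M\<^sub>P\<^esub> X" .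
  next
    fix X assume "X \<in> carrier M\<^sub>P"
    then obtain x s where "x \<in> carrier M" "s \<in> carrier R - P" "X = fr x s"
      by (rule fr_cases)
    then show "\<one>\<^bsub>S\<^esub> \<odot>\<^bsub>M\<^sub>P\<^esub> X = X"
      by (simp add: fr_smult lsmult_one)
  qed
  ultimately show ?thesis
    using S.ring_axioms by (simp add: left_module_def)
qed

lemma to_module_localization_eq: "to_module_localization R S P M x = fr x \<one>"
  by (simp add: to_module_localization_def)

text \<open>A fraction \<open>x/s\<close> vanishes exactly when some \<open>u\<close> outside
  \<open>P\<close> kills \<open>x\<close>, whatever \<open>s\<close> is.\<close>

lemma mem_Supp_iff:
  "P \<in> Supp R S M \<longleftrightarrow> (\<exists>x\<in>carrier M. \<forall>u\<in>carrier R - P. u \<odot>\<^bsub>N\<^esub> x \<noteq> \<zero>\<^bsub>M\<^esub>)"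
proof -
  have zero_iff: "fr x s = \<zero>\<^bsub>M\<^sub>P\<^esub> \<longleftrightarrow> (\<exists>u\<in>carrier R - P. u \<odot>\<^bsub>N\<^esub> x = \<zero>\<^bsub>M\<^esub>)"
    if "x \<in> carrier M" "s \<in> carrier R - P" for x s
    using that one_compl unfolding zero_localization by (subst N.fraction_eq_iff) auto
  have "P \<in> Supp R S M \<longleftrightarrow> (\<exists>X\<in>carrier M\<^sub>P. X \<noteq> \<zero>\<^bsub>M\<^sub>P\<^esub>)"
    using primeideal_axioms fr_closed[OF M.zero_closed one_compl]
    by (auto simp: Supp_def Spec_def zero_localization)
  also have "\<dots> \<longleftrightarrow> (\<exists>x\<in>carrier M. \<forall>u\<in>carrier R - P. u \<odot>\<^bsub>N\<^esub> x \<noteq> \<zero>\<^bsub>M\<^esub>)"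
    using zero_iff fr_closed one_compl by (metis fr_cases)
  finally show ?thesis .
qed

text \<open>Division by elements outside \<open>P\<close> is already possible in \<open>M\<close>:
  the fraction \<open>x/s\<close> equals \<open>y/1\<close> for the \<open>y\<close> with
  \<open>s y = x\<close>. Injectivity of these multiplications keeps the map to the localization
  injective.\<close>

lemma to_module_localization_iso:
  assumes bij: "\<And>s. s \<in> carrier R - P \<Longrightarrow> bij_betw (\<lambda>x. s \<odot>\<^bsub>N\<^esub> x) (carrier M) (carrier M)"
  shows "to_module_localization R S P M \<in> lmod_iso S M M\<^sub>P"
proof -
  have inj: "x = y" if "s \<in> carrier R - P" "s \<odot>\<^bsub>N\<^esub> x = s \<odot>\<^bsub>N\<^esub> y" "x \<in> carrier M" "y \<in> carrier M" for s x y
    using bij[OF that(1)] that(2-) by (auto simp: bij_betw_def inj_on_def)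
  have "to_module_localization R S P M \<in> lmod_hom S M M\<^sub>P"
    using one_compl
    by (auto simp: lmod_hom_def to_module_localization_eq fr_closed fr_add fr_smult)
  moreover have "inj_on (to_module_localization R S P M) (carrier M)"
    using one_compl inj by (auto simp: inj_on_def to_module_localization_eq N.fraction_eq_iff)
  moreover have "X \<in> to_module_localization R S P M ` carrier M" if X: "X \<in> carrier M\<^sub>P" for X
  proof -
    obtain x s where x: "x \<in> carrier M" "s \<in> carrier R - P" "X = fr x s"
      using fr_cases[OF X] .
    then obtain y where y: "y \<in> carrier M" "x = s \<odot>\<^bsub>N\<^esub> y"
      using bij[of s] by (auto simp: bij_betw_def)
    then have "X = fr y \<one>"
      unfolding x(3) using x(1,2) one_compl by (intro N.fraction_eqI) auto
    with y(1) show ?thesis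
      by (auto simp: to_module_localization_eq)
  qed
  ultimately show ?thesis
    by (auto simp: lmod_iso_def bij_betw_def lmod_hom_def)
qed

end

section \<open>Surjectivity of the localization maps\<close>

lemma regular_module_simps [simp]:
  "carrier (regular_module R) = carrier R"
  "(\<otimes>\<^bsub>regular_module R\<^esub>) = (\<otimes>\<^bsub>R\<^esub>)"
  "one (regular_module R) = one R"
  "add (regular_module R) = add R"
  "zero (regular_module R) = zero R"
  "(\<odot>\<^bsub>regular_module R\<^esub>) = (\<otimes>\<^bsub>R\<^esub>)"
  by (simp_all add: regular_module_def)

text \<open>\<open>R\<close> over itself serves twice: as the module whose fractions make up the
  localized ring, and later as both the algebra and the module from which an example is
  built.\<close>

lemma (in cring) unital_algebra_regular_module: "unital_algebra R (regular_module R)"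
proof -
  have g: "abelian_group (regular_module R)"
    by (rule abelian_groupI) (auto simp: a_ac intro: l_neg)
  have "Module.module R (regular_module R)"
    by (rule moduleI[OF is_cring g]) (simp_all add: l_distr r_distr m_assoc)
  moreover have "ring (regular_module R)"
    by (rule ringI[OF g]) (auto intro!: monoidI simp: l_distr r_distr m_assoc)
  ultimately show ?thesis
    by (simp add: unital_algebra_def unital_algebra_axioms_def m_ac)
qed

lemma (in primeideal) prime_localization_regular_module:
  "prime_localization R (regular_module R) I"
  using unital_algebra_regular_module primeideal_axioms
  by (simp add: prime_localization_def unital_algebra_def)

text \<open>The right side says that each \<open>1/s\<close> is of the form \<open>a/1\<close>. This
  suffices for surjectivity, since then \<open>b/s\<close> equals \<open>(a b)/1\<close>.\<close>

lemma (in primeideal) to_ring_localization_surj_iff: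
  "to_ring_localization R I ` carrier R = carrier (ring_localization R I) \<longleftrightarrow>
    (\<forall>s\<in>carrier R - I. \<exists>a\<in>carrier R. \<exists>u\<in>carrier R - I. u \<otimes> (s \<otimes> a) = u)"
proof -
  interpret Q: prime_localization R "regular_module R" I
    by (rule prime_localization_regular_module)
  let ?fr = "fraction R I (regular_module R)"
  have frac: "b \<in> carrier R \<Longrightarrow> s \<in> carrier R - I \<Longrightarrow> a \<in> carrier R \<Longrightarrow>
      ?fr b s = ?fr a \<one> \<longleftrightarrow> (\<exists>u\<in>carrier R - I. u \<otimes> b = u \<otimes> (s \<otimes> a))" for b s a
    using one_compl by (simp add: Q.fraction_eq_iff)
  have A: "to_ring_localization R I ` carrier R = {?fr a \<one> | a. a \<in> carrier R}"
    by (auto simp: to_ring_localization_def)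
  have B: "carrier (ring_localization R I) =
      {?fr b s | b s. b \<in> carrier R \<and> s \<in> carrier R - I}"
    by (simp add: ring_localization_def Let_def)
  have sub: "{?fr a \<one> | a. a \<in> carrier R} \<subseteq> {?fr b s | b s. b \<in> carrier R \<and> s \<in> carrier R - I}"
    using one_compl by (intro Collect_mono impI) metis
  have "to_ring_localization R I ` carrier R = carrier (ring_localization R I) \<longleftrightarrow>
      {?fr b s | b s. b \<in> carrier R \<and> s \<in> carrier R - I} \<subseteq> {?fr a \<one> | a. a \<in> carrier R}"
    unfolding A B by (rule iffI[OF equalityD2 subset_antisym[OF sub]])
  also have "\<dots> \<longleftrightarrow> (\<forall>b\<in>carrier R. \<forall>s\<in>carrier R - I. \<exists>a\<in>carrier R. ?fr b s = ?fr a \<one>)"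
    unfolding Collect_mono_iff by metis
  also have "\<dots> \<longleftrightarrow> (\<forall>b\<in>carrier R. \<forall>s\<in>carrier R - I. \<exists>a\<in>carrier R. \<exists>u\<in>carrier R - I.
      u \<otimes> b = u \<otimes> (s \<otimes> a))"
    using frac by simp
  also have "\<dots> \<longleftrightarrow> (\<forall>s\<in>carrier R - I. \<exists>a\<in>carrier R. \<exists>u\<in>carrier R - I. u \<otimes> (s \<otimes> a) = u)"
    (is "?l \<longleftrightarrow> ?r")
  proof
    assume ?l
    then show ?r
      by (metis DiffD1 one_closed r_one)
  next
    assume r: ?r
    show ?l
    proof (intro ballI)
      fix b s assume b: "b \<in> carrier R" and s: "s \<in> carrier R - I"
      obtain a u where au: "a \<in> carrier R" "u \<in> carrier R - I" "u \<otimes> (s \<otimes> a) = u"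
        using r s by blast
      have "u \<otimes> (s \<otimes> (a \<otimes> b)) = u \<otimes> (s \<otimes> a) \<otimes> b"
        using b s au(1,2) by (simp add: m_assoc)
      then show "\<exists>a\<in>carrier R. \<exists>u\<in>carrier R - I. u \<otimes> b = u \<otimes> (s \<otimes> a)"
        using au b by (metis m_closed)
    qed
  qed
  finally show ?thesis .
qed

text \<open>The set is the kernel of the map from \<open>R\<close> to its localization at
  \<open>I\<close>. A sum is killed by the product of elements killing the summands, and this
  product stays outside the prime \<open>I\<close>.\<close>

lemma (in primeideal) ideal_kernel_localization:
  "ideal {x \<in> carrier R. \<exists>u\<in>carrier R - I. u \<otimes> x = \<zero>} R"
proof (rule idealI[OF ring_axioms])
  let ?K = "{x \<in> carrier R. \<exists>u\<in>carrier R - I. u \<otimes> x = \<zero>}"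
  show "subgroup ?K (add_monoid R)"
  proof
    fix x y assume "x \<in> ?K" "y \<in> ?K"
    then obtain u v where uv: "u \<in> carrier R - I" "v \<in> carrier R - I" "u \<otimes> x = \<zero>" "v \<otimes> y = \<zero>"
      and xy: "x \<in> carrier R" "y \<in> carrier R"
      by auto
    have "(u \<otimes> v) \<otimes> (x \<oplus> y) = v \<otimes> (u \<otimes> x) \<oplus> u \<otimes> (v \<otimes> y)"
      using uv(1,2) xy by (simp add: r_distr m_ac)
    also have "\<dots> = \<zero>"
      using uv by simp
    finally show "x \<otimes>\<^bsub>add_monoid R\<^esub> y \<in> ?K"
      using mult_compl[OF uv(1,2)] xy by auto
  next
    fix x assume "x \<in> ?K"
    then show "inv\<^bsub>add_monoid R\<^esub> x \<in> ?K"
      by (auto simp: r_minus simp flip: a_inv_def)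
  qed (use one_compl in auto)
next
  let ?K = "{x \<in> carrier R. \<exists>u\<in>carrier R - I. u \<otimes> x = \<zero>}"
  fix a x assume ax: "a \<in> ?K" "x \<in> carrier R"
  then obtain u where u: "u \<in> carrier R - I" "u \<otimes> a = \<zero>" "a \<in> carrier R" by auto
  have "u \<otimes> (a \<otimes> x) = (u \<otimes> a) \<otimes> x"
    using u(1,3) ax(2) by (simp add: m_assoc)
  then show *: "a \<otimes> x \<in> ?K"
    using u ax(2) by auto
  then show "x \<otimes> a \<in> ?K"
    using u(3) ax(2) by (simp add: m_comm)
qed

text \<open>The kernel \<open>K\<close> of localization at \<open>P\<close> and the element
  \<open>s\<close> generate the unit ideal. A maximal ideal \<open>Q\<close> above both would
  contain \<open>s\<close>, hence differ from \<open>P\<close>; separation would then give some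
  \<open>v\<close> in \<open>K\<close> outside \<open>Q\<close>. Multiplying
  \<open>\<one> = x \<oplus> r \<otimes> s\<close> by some \<open>u\<close> that kills
  \<open>x\<close> makes \<open>r\<close> the required inverse.\<close>

lemma (in cring) gelfand_ring_imp_local_inverse:
  assumes G: "gelfand_ring R" and P: "maximalideal P R" and s: "s \<in> carrier R - P"
  shows "\<exists>a\<in>carrier R. \<exists>u\<in>carrier R - P. u \<otimes> (s \<otimes> a) = u"
proof -
  interpret P: primeideal P R by (rule maximalideal_prime[OF P])
  define K where "K = {x \<in> carrier R. \<exists>u\<in>carrier R - P. u \<otimes> x = \<zero>}"
  have K: "ideal K R"
    unfolding K_def by (rule P.ideal_kernel_localization)
  define J where "J = K <+>\<^bsub>R\<^esub> PIdl s"
  have J: "ideal J R"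
    unfolding J_def using K s by (intro add_ideals cgenideal_ideal) auto
  have mem: "x \<oplus> r \<otimes> s \<in> J" if "x \<in> K" "r \<in> carrier R" for x r
    using that unfolding J_def set_add_def' cgenideal_def by blast
  have "J = carrier R"
  proof (rule ccontr)
    assume "J \<noteq> carrier R"
    then obtain Q where Q: "maximalideal Q R" "J \<subseteq> Q"
      using ex_maximalideal[OF J] by blast
    have "s \<in> Q"
      using mem[of \<zero> \<one>] s Q(2) P.one_compl by (auto simp: K_def)
    then have "P \<noteq> Q"
      using s by auto
    then obtain u v where uv: "u \<in> carrier R - P" "v \<in> carrier R - Q" "u \<otimes> v = \<zero>"
      using gelfand_separation[OF G P Q(1)] by blast
    then have "v \<in> J"
      using mem[of v \<zero>] s by (auto simp: K_def)
    with uv(2) Q(2) show False by auto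
  qed
  then have "\<one> \<in> J" by simp
  then obtain x r where xr: "x \<in> K" "r \<in> carrier R" "\<one> = x \<oplus> r \<otimes> s"
    unfolding J_def set_add_def' cgenideal_def by blast
  then obtain u where u: "u \<in> carrier R - P" "u \<otimes> x = \<zero>" "x \<in> carrier R"
    by (auto simp: K_def)
  have "u = u \<otimes> (x \<oplus> r \<otimes> s)"
    unfolding xr(3)[symmetric] using u by simp
  also have "\<dots> = u \<otimes> (s \<otimes> r)"
    using u xr(2) s by (simp add: r_distr m_comm)
  finally show ?thesis
    using xr(2) u(1) by metis
qed

text \<open>Let \<open>s\<close> be in \<open>Q\<close> but not in \<open>P\<close>. Then
  \<open>u (1 - s a) = 0\<close> with \<open>u\<close> outside \<open>P\<close>, hence outside the
  common prime \<open>L\<close>, so \<open>1 - s a\<close> lies in \<open>L\<close> and thus in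
  \<open>Q\<close>. As \<open>s a\<close> is in \<open>Q\<close> too, \<open>Q\<close> would contain
  \<open>\<one>\<close>. The roles of \<open>P\<close> and \<open>Q\<close> can be
  exchanged.\<close>

lemma (in cring) gelfand_ring_if_local_inverse:
  assumes inv: "\<And>P s. maximalideal P R \<Longrightarrow> s \<in> carrier R - P \<Longrightarrow>
    \<exists>a\<in>carrier R. \<exists>u\<in>carrier R - P. u \<otimes> (s \<otimes> a) = u"
  shows "gelfand_ring R"
proof -
  have "Q \<subseteq> P" if L: "primeideal L R" and P: "maximalideal P R" and Q: "maximalideal Q R"
    and LP: "L \<subseteq> P" and LQ: "L \<subseteq> Q" for L P Q
  proof (rule ccontr)
    interpret L: primeideal L R by fact
    interpret Q: primeideal Q R by (rule maximalideal_prime[OF Q])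
    assume "\<not> Q \<subseteq> P"
    then obtain s where s: "s \<in> Q" "s \<notin> P" by auto
    then have s': "s \<in> carrier R" using Q.Icarr by auto
    then obtain a u where au: "a \<in> carrier R" "u \<in> carrier R - P" "u \<otimes> (s \<otimes> a) = u"
      using inv[OF P] s by blast
    then have "u \<otimes> (\<one> \<ominus> s \<otimes> a) = \<zero>"
      using s' by (simp add: a_minus_def r_distr r_minus r_neg)
    then have "\<one> \<ominus> s \<otimes> a \<in> L"
      using L.I_prime[of u "\<one> \<ominus> s \<otimes> a"] LP au s' by auto
    then have "(\<one> \<ominus> s \<otimes> a) \<oplus> s \<otimes> a \<in> Q"
      using LQ s(1) au(1) by (auto intro!: Q.a_closed Q.I_r_closed)
    then show False
      using Q.one_compl s' au(1) by (simp add: a_minus_def a_assoc l_neg)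
  qed
  then show ?thesis
    unfolding gelfand_ring_iff by blast
qed

lemma (in cring) gelfand_ring_iff_localization_surj:
  "gelfand_ring R \<longleftrightarrow> (\<forall>P\<in>Max_Spec R.
    to_ring_localization R P ` carrier R = carrier (ring_localization R P))"
proof -
  have "to_ring_localization R P ` carrier R = carrier (ring_localization R P) \<longleftrightarrow>
      (\<forall>s\<in>carrier R - P. \<exists>a\<in>carrier R. \<exists>u\<in>carrier R - P. u \<otimes> (s \<otimes> a) = u)"
    if "P \<in> Max_Spec R" for P
    using primeideal.to_ring_localization_surj_iff[OF maximalideal_prime] that
    by (simp add: Max_Spec_def)
  then show ?thesis
    using gelfand_ring_imp_local_inverse gelfand_ring_if_local_inverse
    by (simp add: Max_Spec_def) blast
qed

section \<open>Modules with local endomorphism ring\<close>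

lemma End_ring_simps:
  "f \<in> carrier (End_ring S M) \<longleftrightarrow> f \<in> lmod_hom S M M \<and> f \<in> extensional (carrier M)"
  "f \<otimes>\<^bsub>End_ring S M\<^esub> g = compose (carrier M) f g"
  "\<one>\<^bsub>End_ring S M\<^esub> = (\<lambda>x\<in>carrier M. x)"
  "\<zero>\<^bsub>End_ring S M\<^esub> = (\<lambda>x\<in>carrier M. \<zero>\<^bsub>M\<^esub>)"
  "f \<oplus>\<^bsub>End_ring S M\<^esub> g = (\<lambda>x\<in>carrier M. f x \<oplus>\<^bsub>M\<^esub> g x)"
  by (simp_all add: End_ring_def)

lemma (in left_module) lsmult_zero: "a \<in> carrier S \<Longrightarrow> a \<odot>\<^bsub>M\<^esub> \<zero>\<^bsub>M\<^esub> = \<zero>\<^bsub>M\<^esub>"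
  using lsmult_r_distr[of a "\<zero>\<^bsub>M\<^esub>" "\<zero>\<^bsub>M\<^esub>"] lsmult_closed[of a "\<zero>\<^bsub>M\<^esub>"] M.zero_closed
  by (metis M.add.l_cancel_one' M.l_zero)

lemma (in left_module) lsmult_minus:
  assumes "a \<in> carrier S" "x \<in> carrier M"
  shows "a \<odot>\<^bsub>M\<^esub> (\<ominus>\<^bsub>M\<^esub> x) = \<ominus>\<^bsub>M\<^esub> (a \<odot>\<^bsub>M\<^esub> x)"
proof -
  have "a \<odot>\<^bsub>M\<^esub> (\<ominus>\<^bsub>M\<^esub> x) \<oplus>\<^bsub>M\<^esub> a \<odot>\<^bsub>M\<^esub> x = \<zero>\<^bsub>M\<^esub>"
    using assms lsmult_r_distr[of a "\<ominus>\<^bsub>M\<^esub> x" x] by (simp add: M.l_neg lsmult_zero)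
  then show ?thesis
    using assms lsmult_closed by (simp add: M.minus_equality)
qed

lemma ring_End_ring:
  fixes M :: "('s, 'm) module"
  assumes "left_module S M"
  shows "ring (End_ring S M)"
proof -
  interpret left_module S M by fact
  let ?E = "End_ring S M"
  \<comment> \<open>All operations of the endomorphism ring return functions restricted to the
    carrier, so one criterion settles closure for all of them.\<close>
  have homI: "(\<lambda>x\<in>carrier M. f x) \<in> carrier ?E"
    if "\<And>x. x \<in> carrier M \<Longrightarrow> f x \<in> carrier M"
      "\<And>x y. x \<in> carrier M \<Longrightarrow> y \<in> carrier M \<Longrightarrow> f (x \<oplus>\<^bsub>M\<^esub> y) = f x \<oplus>\<^bsub>M\<^esub> f y"
      "\<And>a x. a \<in> carrier S \<Longrightarrow> x \<in> carrier M \<Longrightarrow> f (a \<odot>\<^bsub>M\<^esub> x) = a \<odot>\<^bsub>M\<^esub> f x" for f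
    using that by (auto simp: End_ring_simps lmod_hom_def Pi_iff lsmult_closed)
  have closed: "f x \<in> carrier M" if "f \<in> lmod_hom S M M" "x \<in> carrier M" for f x
    using that by (auto simp: lmod_hom_def Pi_iff)
  have eqI: "f = g" if "f \<in> extensional (carrier M)" "g \<in> extensional (carrier M)"
      "\<And>x. x \<in> carrier M \<Longrightarrow> f x = g x" for f g :: "'m \<Rightarrow> 'm"
    using that by (rule extensionalityI)
  have add: "f \<oplus>\<^bsub>?E\<^esub> g \<in> carrier ?E" if "f \<in> carrier ?E" "g \<in> carrier ?E" for f g
    unfolding End_ring_simps(5)
    using that by (intro homI) (auto simp: End_ring_simps(1) lmod_hom_def Pi_iff M.a_ac lsmult_r_distr)
  have mult: "f \<otimes>\<^bsub>?E\<^esub> g \<in> carrier ?E" if "f \<in> carrier ?E" "g \<in> carrier ?E" for f g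
    unfolding End_ring_simps(2) compose_def
    using that by (intro homI) (auto simp: End_ring_simps(1) lmod_hom_def Pi_iff)
  have zero: "\<zero>\<^bsub>?E\<^esub> \<in> carrier ?E"
    unfolding End_ring_simps(4) by (intro homI) (auto simp: lsmult_zero)
  have one: "\<one>\<^bsub>?E\<^esub> \<in> carrier ?E"
    unfolding End_ring_simps(3) by (intro homI) auto
  have neg: "(\<lambda>x\<in>carrier M. \<ominus>\<^bsub>M\<^esub> f x) \<in> carrier ?E" if "f \<in> carrier ?E" for f
    using that
    by (intro homI) (auto simp: End_ring_simps(1) lmod_hom_def Pi_iff M.minus_add M.a_comm lsmult_minus)
  show ?thesis
  proof (rule ringI)
    show "abelian_group ?E"
    proof (rule abelian_groupI)
      fix f g h assume "f \<in> carrier ?E" "g \<in> carrier ?E" "h \<in> carrier ?E"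
      then have c: "f x \<in> carrier M" "g x \<in> carrier M" "h x \<in> carrier M" if "x \<in> carrier M" for x
        using that closed by (auto simp: End_ring_simps(1))
      show "f \<oplus>\<^bsub>?E\<^esub> g = g \<oplus>\<^bsub>?E\<^esub> f"
        using c by (auto simp: End_ring_simps M.a_comm restrict_def)
      show "f \<oplus>\<^bsub>?E\<^esub> g \<oplus>\<^bsub>?E\<^esub> h = f \<oplus>\<^bsub>?E\<^esub> (g \<oplus>\<^bsub>?E\<^esub> h)"
        using c by (auto simp: End_ring_simps M.a_assoc restrict_def)
    next
      fix f assume f: "f \<in> carrier ?E"
      show "\<zero>\<^bsub>?E\<^esub> \<oplus>\<^bsub>?E\<^esub> f = f"
        using f closed by (intro eqI) (auto simp: End_ring_simps)
      show "\<exists>g\<in>carrier ?E. g \<oplus>\<^bsub>?E\<^esub> f = \<zero>\<^bsub>?E\<^esub>"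
        using f closed by (intro bexI[OF _ neg[OF f]] eqI) (auto simp: End_ring_simps M.l_neg)
    qed (auto simp: add zero)
    show "monoid ?E"
    proof (rule monoidI)
      fix f g h assume "f \<in> carrier ?E" "g \<in> carrier ?E" "h \<in> carrier ?E"
      then show "f \<otimes>\<^bsub>?E\<^esub> g \<otimes>\<^bsub>?E\<^esub> h = f \<otimes>\<^bsub>?E\<^esub> (g \<otimes>\<^bsub>?E\<^esub> h)"
        using closed by (auto simp: End_ring_simps compose_def restrict_def)
    next
      fix f assume f: "f \<in> carrier ?E"
      show "\<one>\<^bsub>?E\<^esub> \<otimes>\<^bsub>?E\<^esub> f = f" "f \<otimes>\<^bsub>?E\<^esub> \<one>\<^bsub>?E\<^esub> = f"
        using f closed by (auto intro!: eqI simp: End_ring_simps compose_def)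
    qed (auto simp: mult one)
    fix f g h assume "f \<in> carrier ?E" "g \<in> carrier ?E" "h \<in> carrier ?E"
    then show "(f \<oplus>\<^bsub>?E\<^esub> g) \<otimes>\<^bsub>?E\<^esub> h = f \<otimes>\<^bsub>?E\<^esub> h \<oplus>\<^bsub>?E\<^esub> g \<otimes>\<^bsub>?E\<^esub> h"
      "h \<otimes>\<^bsub>?E\<^esub> (f \<oplus>\<^bsub>?E\<^esub> g) = h \<otimes>\<^bsub>?E\<^esub> f \<oplus>\<^bsub>?E\<^esub> h \<otimes>\<^bsub>?E\<^esub> g"
      by (auto simp: End_ring_simps compose_def restrict_def fun_eq_iff lmod_hom_def Pi_iff)
  qed
qed

section \<open>The base ring acting through a local endomorphism ring\<close>

context algebra_module
begin

abbreviation E where "E \<equiv> End_ring S M"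

lemma homothety_ring_hom: "(\<lambda>r. \<lambda>x\<in>carrier M. r \<odot>\<^bsub>N\<^esub> x) \<in> ring_hom R E"
proof (rule ring_hom_memI)
  show "(\<lambda>x\<in>carrier M. r \<odot>\<^bsub>N\<^esub> x) \<in> carrier E" if "r \<in> carrier R" for r
    using that
    by (auto simp: End_ring_simps lmod_hom_def Pi_iff N.smult_r_distr smult_restrict_commute lsmult_closed)
qed (auto simp: End_ring_simps compose_def restrict_def N.smult_assoc1 N.smult_l_distr fun_eq_iff)

lemma Units_End_bij_betw:
  assumes "f \<in> Units E"
  shows "bij_betw f (carrier M) (carrier M)"
proof -
  obtain g where fg: "f \<in> carrier E" "g \<in> carrier E" "g \<otimes>\<^bsub>E\<^esub> f = \<one>\<^bsub>E\<^esub>" "f \<otimes>\<^bsub>E\<^esub> g = \<one>\<^bsub>E\<^esub>"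
    using assms by (auto simp: Units_def)
  show ?thesis
  proof (rule bij_betw_byWitness[where f' = g])
    show "\<forall>x\<in>carrier M. g (f x) = x" "\<forall>x\<in>carrier M. f (g x) = x"
      using fg(3,4) by (auto simp: End_ring_simps compose_def fun_eq_iff restrict_def split: if_splits)
  qed (use fg(1,2) in \<open>auto simp: End_ring_simps lmod_hom_def Pi_iff\<close>)
qed

text \<open>\<open>L\<close> is the preimage of the ideal of non-units under the ring homomorphism
  that sends \<open>r\<close> to multiplication by \<open>r\<close>. It is prime because products of
  units are units, and units of \<open>E\<close> are bijections of \<open>M\<close>.\<close>

lemma local_End_obtains_prime:
  assumes "local_ring E"
  obtains L where "primeideal L R"
    "\<And>s. s \<in> carrier R - L \<Longrightarrow> bij_betw (\<lambda>x. s \<odot>\<^bsub>N\<^esub> x) (carrier M) (carrier M)"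
proof -
  interpret E: ring E
    using assms by (simp add: local_ring_def)
  let ?h = "\<lambda>r. \<lambda>x\<in>carrier M. r \<odot>\<^bsub>N\<^esub> x"
  interpret h: ring_hom_ring R E ?h
    using homothety_ring_hom by (intro ring_hom_ringI2 R.ring_axioms E.ring_axioms)
  define L where "L = {r \<in> carrier R. ?h r \<in> carrier E - Units E}"
  have L_iff: "r \<in> L \<longleftrightarrow> ?h r \<notin> Units E" if "r \<in> carrier R" for r
    using that h.hom_closed by (auto simp: L_def)
  have "primeideal L R"
  proof (rule primeidealI)
    show "ideal L R"
      unfolding L_def using assms by (intro h.ideal_vimage) (simp add: local_ring_def)
    show "carrier R \<noteq> L"
      using L_iff[of \<one>] h.hom_one by auto
    show "a \<in> L \<or> b \<in> L" if "a \<in> carrier R" "b \<in> carrier R" "a \<otimes> b \<in> L" for a b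
    proof (rule ccontr)
      assume "\<not> (a \<in> L \<or> b \<in> L)"
      then have "?h a \<otimes>\<^bsub>E\<^esub> ?h b \<in> Units E"
        using that L_iff by (intro E.Units_m_closed) auto
      then show False
        using L_iff[of "a \<otimes> b"] that unfolding h.hom_mult[OF that(1,2)] by simp
    qed
  qed (rule is_cring)
  moreover have "bij_betw (\<lambda>x. s \<odot>\<^bsub>N\<^esub> x) (carrier M) (carrier M)" if "s \<in> carrier R - L" for s
  proof -
    have "?h s \<in> Units E"
      using that L_iff by auto
    then show ?thesis
      using Units_End_bij_betw[of "?h s"] by (simp cong: bij_betw_cong)
  qed
  ultimately show thesis
    using that by blast
qed

lemma local_End_Supp:
  assumes G: "gelfand_ring R" and local: "local_ring E"
  shows "\<exists>P. Supp R S M \<inter> Max_Spec R = {P}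
    \<and> to_module_localization R S P M \<in> lmod_iso S M (module_localization R S P M)"
proof -
  obtain L where L: "primeideal L R"
    and bij_L: "\<And>s. s \<in> carrier R - L \<Longrightarrow> bij_betw (\<lambda>x. s \<odot>\<^bsub>N\<^esub> x) (carrier M) (carrier M)"
    using local_End_obtains_prime[OF local] by blast
  obtain P where P: "maximalideal P R" and LP: "L \<subseteq> P"
    using R.ex_maximalideal[OF primeideal.axioms(1)[OF L]] primeideal.I_notcarr[OF L] by metis
  \<comment> \<open>As \<open>L\<close> lies in \<open>P\<close>, everything outside
    \<open>P\<close> is outside \<open>L\<close>.\<close>
  note bij = bij_L[OF subsetD[OF Diff_mono[OF order_refl LP]]]
  have zero: "x = \<zero>\<^bsub>M\<^esub>" if "u \<in> carrier R - P" "x \<in> carrier M" "u \<odot>\<^bsub>N\<^esub> x = \<zero>\<^bsub>M\<^esub>" for u x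
    using bij[OF that(1)] that N.smult_r_null[of u]
    by (metis DiffD1 M.zero_closed bij_betw_imp_inj_on inj_onD)
  interpret P: primeideal P R by (rule R.maximalideal_prime[OF P])
  interpret MP: algebra_module_prime R S M P ..
  \<comment> \<open>A zero module has only the zero endomorphism, whereas a local ring is
    nonzero.\<close>
  have "carrier M \<noteq> {\<zero>\<^bsub>M\<^esub>}"
  proof
    assume M0: "carrier M = {\<zero>\<^bsub>M\<^esub>}"
    have "f = \<zero>\<^bsub>E\<^esub>" if "f \<in> carrier E" for f
      using that M0 by (intro extensionalityI[of _ "carrier M"]) (auto simp: End_ring_simps lmod_hom_def Pi_iff)
    then have "carrier E = {\<zero>\<^bsub>E\<^esub>}"
      using ring.ring_simprules(2)[OF ring_End_ring[OF L.left_module_axioms]] by blast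
    then show False
      using local by (simp add: local_ring_def)
  qed
  then obtain x where "x \<in> carrier M" "x \<noteq> \<zero>\<^bsub>M\<^esub>"
    using M.zero_closed by blast
  then have "P \<in> Supp R S M"
    unfolding MP.mem_Supp_iff using zero by blast
  moreover have "Q = P" if Q: "Q \<in> Supp R S M" "maximalideal Q R" for Q
  proof (rule ccontr)
    interpret Q: primeideal Q R by (rule R.maximalideal_prime[OF Q(2)])
    interpret MQ: algebra_module_prime R S M Q ..
    assume "Q \<noteq> P"
    then obtain u v where uv: "u \<in> carrier R - P" "v \<in> carrier R - Q" "u \<otimes> v = \<zero>"
      using R.gelfand_separation[OF G P Q(2)] by blast
    \<comment> \<open>The element \<open>u\<close> acts injectively and \<open>u (v x) = 0\<close>,
      so \<open>v\<close> kills all of \<open>M\<close> and the localization at \<open>Q\<close>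
      vanishes.\<close>
    have "v \<odot>\<^bsub>N\<^esub> x = \<zero>\<^bsub>M\<^esub>" if "x \<in> carrier M" for x
    proof (rule zero[OF uv(1)])
      have "u \<odot>\<^bsub>N\<^esub> (v \<odot>\<^bsub>N\<^esub> x) = (u \<otimes> v) \<odot>\<^bsub>N\<^esub> x"
        using uv(1,2) that N.smult_assoc1[of u v x] by simp
      then show "u \<odot>\<^bsub>N\<^esub> (v \<odot>\<^bsub>N\<^esub> x) = \<zero>\<^bsub>M\<^esub>"
        using uv(3) that by simp
    qed (use uv(2) that in simp)
    then show False
      using Q(1) uv(2) unfolding MQ.mem_Supp_iff by blast
  qed
  ultimately have "Supp R S M \<inter> Max_Spec R = {P}"
    using P unfolding Max_Spec_def by blast
  then show ?thesis
    using MP.to_module_localization_iso[OF bij] by blast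
qed

end

section \<open>Endomorphism rings of localizations\<close>

context algebra_module
begin

lemma bij_betw_imp_Units_End:
  assumes f: "f \<in> carrier E" and bij: "bij_betw f (carrier M) (carrier M)"
  shows "f \<in> Units E"
proof -
  \<comment> \<open>The restriction makes the inverse map extensional, as membership in
    \<open>E\<close> demands.\<close>
  let ?g = "\<lambda>x\<in>carrier M. inv_into (carrier M) f x"
  have hom: "f (x \<oplus>\<^bsub>M\<^esub> y) = f x \<oplus>\<^bsub>M\<^esub> f y" "a \<in> carrier S \<Longrightarrow> f (a \<odot>\<^bsub>M\<^esub> x) = a \<odot>\<^bsub>M\<^esub> f x"
    if "x \<in> carrier M" "y \<in> carrier M" for x y a
    using f that by (auto simp: End_ring_simps lmod_hom_def)
  have g: "inv_into (carrier M) f x \<in> carrier M" "f (inv_into (carrier M) f x) = x"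
    if "x \<in> carrier M" for x
    using bij that by (auto simp: bij_betw_def f_inv_into_f inv_into_into)
  have gI: "inv_into (carrier M) f x = y" if "y \<in> carrier M" "f y = x" for x y
    using bij that by (auto simp: bij_betw_def)
  have "?g \<in> carrier E"
    using g hom by (auto simp: End_ring_simps lmod_hom_def lsmult_closed intro!: gI)
  moreover have "?g \<otimes>\<^bsub>E\<^esub> f = \<one>\<^bsub>E\<^esub>"
    using f gI
    by (auto simp: End_ring_simps compose_def restrict_def lmod_hom_def fun_eq_iff Pi_iff)
  moreover have "f \<otimes>\<^bsub>E\<^esub> ?g = \<one>\<^bsub>E\<^esub>"
    using g by (auto simp: End_ring_simps compose_def restrict_def fun_eq_iff)
  ultimately show ?thesis
    using f by (auto simp: Units_def)
qed

lemma End_smult_commute: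
  "\<lbrakk>f \<in> carrier E; r \<in> carrier R; x \<in> carrier M\<rbrakk> \<Longrightarrow> f (r \<odot>\<^bsub>N\<^esub> x) = r \<odot>\<^bsub>N\<^esub> f x"
  by (simp add: End_ring_simps lmod_hom_def smult_restrict_scalars)

lemma End_closed: "\<lbrakk>f \<in> carrier E; x \<in> carrier M\<rbrakk> \<Longrightarrow> f x \<in> carrier M"
  by (auto simp: End_ring_simps lmod_hom_def)

text \<open>An intrinsic form of the fact that the endomorphism ring of R_L is R_L. Every
  endomorphism is multiplication by a fraction \<open>a/s\<close>, read off from its value at
  \<open>e\<close>, and it is a unit exactly when \<open>a\<close> is outside \<open>L\<close>.
  Bijective action and a generator are assumed, instead of a carrier of fractions, so that the lemma
  applies to copies of R_L in other types.\<close>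

lemma local_End_if_localized_cyclic:
  assumes L: "primeideal L R"
    and bij: "\<And>s. s \<in> carrier R - L \<Longrightarrow> bij_betw (\<lambda>x. s \<odot>\<^bsub>N\<^esub> x) (carrier M) (carrier M)"
    and e: "e \<in> carrier M"
    and gen: "\<And>x. x \<in> carrier M \<Longrightarrow> \<exists>s\<in>carrier R - L. \<exists>a\<in>carrier R. s \<odot>\<^bsub>N\<^esub> x = a \<odot>\<^bsub>N\<^esub> e"
    and nz: "carrier M \<noteq> {\<zero>\<^bsub>M\<^esub>}"
  shows "local_ring E"
proof -
  interpret L: primeideal L R by fact
  interpret E: ring E
    by (rule ring_End_ring[OF L.left_module_axioms])
  have cancel: "x = y"
    if "s \<in> carrier R - L" "x \<in> carrier M" "y \<in> carrier M" "s \<odot>\<^bsub>N\<^esub> x = s \<odot>\<^bsub>N\<^esub> y" for s x y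
    using bij[OF that(1)] that(2-) by (auto simp: bij_betw_def inj_on_def)
  \<comment> \<open>\<open>rep f s a\<close> says that \<open>f\<close> is multiplication by \<open>a/s\<close>.\<close>
  define rep where "rep f s a \<longleftrightarrow> s \<in> carrier R - L \<and> a \<in> carrier R \<and>
    (\<forall>x\<in>carrier M. s \<odot>\<^bsub>N\<^esub> f x = a \<odot>\<^bsub>N\<^esub> x)" for f s a
  have ex_rep: "\<exists>s a. rep f s a" if f: "f \<in> carrier E" for f
  proof -
    obtain s a where s: "s \<in> carrier R - L" and a: "a \<in> carrier R" and sa: "s \<odot>\<^bsub>N\<^esub> f e = a \<odot>\<^bsub>N\<^esub> e"
      using gen[of "f e"] f e End_closed by blast
    have "s \<odot>\<^bsub>N\<^esub> f x = a \<odot>\<^bsub>N\<^esub> x" if x: "x \<in> carrier M" for x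
    proof -
      \<comment> \<open>Up to the invertible factor \<open>t\<close>, the element \<open>x\<close>
        is a multiple of \<open>e\<close>, so the equation follows from the one at \<open>e\<close>
        after cancelling \<open>t\<close>.\<close>
      obtain t b where t: "t \<in> carrier R - L" and b: "b \<in> carrier R" and tb: "t \<odot>\<^bsub>N\<^esub> x = b \<odot>\<^bsub>N\<^esub> e"
        using gen[OF x] by blast
      note c = s a t b x e f End_closed[OF f]
      have "t \<odot>\<^bsub>N\<^esub> (s \<odot>\<^bsub>N\<^esub> f x) = s \<odot>\<^bsub>N\<^esub> f (t \<odot>\<^bsub>N\<^esub> x)"
        using c by (simp add: End_smult_commute N.smult_assoc1[symmetric] m_comm)
      also have "\<dots> = b \<odot>\<^bsub>N\<^esub> (s \<odot>\<^bsub>N\<^esub> f e)"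
        unfolding tb using c by (simp add: End_smult_commute N.smult_assoc1[symmetric] m_comm)
      also have "\<dots> = a \<odot>\<^bsub>N\<^esub> (b \<odot>\<^bsub>N\<^esub> e)"
        unfolding sa using c by (simp add: N.smult_assoc1[symmetric] m_comm)
      also have "\<dots> = t \<odot>\<^bsub>N\<^esub> (a \<odot>\<^bsub>N\<^esub> x)"
        unfolding tb[symmetric] using c by (simp add: N.smult_assoc1[symmetric] m_comm)
      finally have eq: "t \<odot>\<^bsub>N\<^esub> (s \<odot>\<^bsub>N\<^esub> f x) = t \<odot>\<^bsub>N\<^esub> (a \<odot>\<^bsub>N\<^esub> x)" .
      show ?thesis
        by (rule cancel[OF t _ _ eq]) (use s a x End_closed[OF f x] in simp_all)
    qed
    then show ?thesis
      using s a unfolding rep_def by blast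
  qed
  have unit: "f \<in> Units E" if f: "f \<in> carrier E" and r: "rep f s a" and "a \<notin> L" for f s a
  proof (rule bij_betw_imp_Units_End[OF f])
    have s: "s \<in> carrier R - L" and a: "a \<in> carrier R - L"
      and sa: "\<And>x. x \<in> carrier M \<Longrightarrow> s \<odot>\<^bsub>N\<^esub> f x = a \<odot>\<^bsub>N\<^esub> x"
      using r \<open>a \<notin> L\<close> by (auto simp: rep_def)
    \<comment> \<open>The composite is multiplication by \<open>a\<close>. Both \<open>a\<close> and
      \<open>s\<close> act bijectively, hence so does \<open>f\<close>.\<close>
    have "bij_betw ((\<lambda>x. s \<odot>\<^bsub>N\<^esub> x) \<circ> f) (carrier M) (carrier M)"
      using bij[OF a] sa by (simp cong: bij_betw_cong)
    then show "bij_betw f (carrier M) (carrier M)"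
      using bij_betw_comp_iff2[OF bij[OF s], of f "carrier M"] End_closed[OF f] by auto
  qed
  have not_unit: "f \<notin> Units E" if r: "rep f s a" and "a \<in> L" for f s a
  proof
    assume f: "f \<in> Units E"
    then have f': "f \<in> carrier E" by auto
    obtain g where g: "g \<in> carrier E" "f \<otimes>\<^bsub>E\<^esub> g = \<one>\<^bsub>E\<^esub>"
      using f by (auto simp: Units_def)
    obtain t b where r': "rep g t b"
      using ex_rep[OF g(1)] by blast
    have s: "s \<in> carrier R - L" and t: "t \<in> carrier R - L" and b: "b \<in> carrier R"
      using r r' by (auto simp: rep_def)
    have a: "a \<in> carrier R" "a \<otimes> b \<in> L"
      using \<open>a \<in> L\<close> b L.Icarr L.I_r_closed by auto
    \<comment> \<open>With \<open>f = a/s\<close> and its inverse \<open>g = b/t\<close>, the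
      fraction \<open>ab/(st)\<close> acts as the identity, so \<open>c\<close> kills
      \<open>M\<close>. But \<open>c\<close> is outside \<open>L\<close>, because
      \<open>a \<otimes> b\<close> is in \<open>L\<close> and \<open>s \<otimes> t\<close> is not;
      it therefore acts injectively and forces \<open>M\<close> to be zero.\<close>
    define c where "c = s \<otimes> t \<ominus> a \<otimes> b"
    have c: "c \<in> carrier R - L"
    proof -
      have "c \<oplus> a \<otimes> b = s \<otimes> t"
        using s t a b by (simp add: c_def a_minus_def R.a_assoc R.l_neg)
      then show ?thesis
        using L.mult_compl[OF s t] L.a_closed[of c "a \<otimes> b"] a s t b by (auto simp: c_def)
    qed
    have "x = \<zero>\<^bsub>M\<^esub>" if x: "x \<in> carrier M" for x
    proof (rule cancel[OF c x])
      have "f (g x) = x"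
        using fun_cong[OF g(2), of x] x by (simp add: End_ring_simps compose_def)
      then have "(s \<otimes> t) \<odot>\<^bsub>N\<^esub> x = t \<odot>\<^bsub>N\<^esub> (s \<odot>\<^bsub>N\<^esub> f (g x))"
        using s t x by (simp add: N.smult_assoc1[symmetric] m_comm)
      also have "\<dots> = a \<odot>\<^bsub>N\<^esub> (t \<odot>\<^bsub>N\<^esub> g x)"
        using r a(1) s t x g(1) End_closed[OF g(1) x]
        by (simp add: rep_def N.smult_assoc1[symmetric] m_comm)
      also have "\<dots> = (a \<otimes> b) \<odot>\<^bsub>N\<^esub> x"
        using r' a(1) b x by (simp add: rep_def N.smult_assoc1)
      finally have eq: "(s \<otimes> t) \<odot>\<^bsub>N\<^esub> x = (a \<otimes> b) \<odot>\<^bsub>N\<^esub> x" .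
      have "c \<odot>\<^bsub>N\<^esub> x = (s \<otimes> t) \<odot>\<^bsub>N\<^esub> x \<oplus>\<^bsub>M\<^esub> \<ominus>\<^bsub>M\<^esub> ((a \<otimes> b) \<odot>\<^bsub>N\<^esub> x)"
        using s t a(1) b x by (simp add: c_def a_minus_def N.smult_l_distr N.smult_l_minus)
      also have "\<dots> = \<zero>\<^bsub>M\<^esub>"
        unfolding eq using a(1) b x by (simp add: M.r_neg)
      finally show "c \<odot>\<^bsub>N\<^esub> x = c \<odot>\<^bsub>N\<^esub> \<zero>\<^bsub>M\<^esub>"
        using c by simp
    qed simp
    then show False
      using nz M.zero_closed by blast
  qed
  define J where "J = carrier E - Units E"
  have J_iff: "f \<in> J \<longleftrightarrow> f \<in> carrier E \<and> (\<exists>s a. rep f s a \<and> a \<in> L)" for f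
    using ex_rep unit not_unit unfolding J_def by blast
  have "ideal J E"
  proof (rule idealI[OF E.ring_axioms])
    \<comment> \<open>The product is represented by \<open>ab/(st)\<close>. The assumption concerns
      \<open>a \<otimes> b\<close> only, so that the fact serves for multiplication from either
      side.\<close>
    have comp: "f \<otimes>\<^bsub>E\<^esub> g \<in> J" if f: "f \<in> carrier E" and g: "g \<in> carrier E"
      and r: "rep f s a" "rep g t b" and ab: "a \<otimes> b \<in> L" for f g s a t b
    proof -
      have c: "s \<in> carrier R - L" "t \<in> carrier R - L" "a \<in> carrier R" "b \<in> carrier R"
        using r by (auto simp: rep_def)
      have "(s \<otimes> t) \<odot>\<^bsub>N\<^esub> f (g x) = (a \<otimes> b) \<odot>\<^bsub>N\<^esub> x" if x: "x \<in> carrier M" for x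
      proof -
        have "(s \<otimes> t) \<odot>\<^bsub>N\<^esub> f (g x) = t \<odot>\<^bsub>N\<^esub> (s \<odot>\<^bsub>N\<^esub> f (g x))"
          using c f g x End_closed by (simp add: N.smult_assoc1[symmetric] m_comm)
        also have "\<dots> = a \<odot>\<^bsub>N\<^esub> (t \<odot>\<^bsub>N\<^esub> g x)"
          using r(1) c g x End_closed[OF g x] by (simp add: rep_def N.smult_assoc1[symmetric] m_comm)
        also have "\<dots> = (a \<otimes> b) \<odot>\<^bsub>N\<^esub> x"
          using r(2) c x by (simp add: rep_def N.smult_assoc1)
        finally show ?thesis .
      qed
      then have "rep (f \<otimes>\<^bsub>E\<^esub> g) (s \<otimes> t) (a \<otimes> b)"
        using c L.mult_compl[OF c(1,2)] by (simp add: rep_def End_ring_simps compose_def)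
      then show ?thesis
        using ab E.m_closed[OF f g] unfolding J_iff by blast
    qed
    fix f g assume f: "f \<in> J" and g: "g \<in> carrier E"
    obtain s a where f': "f \<in> carrier E" "rep f s a" "a \<in> L"
      using f unfolding J_iff by blast
    obtain t b where g': "rep g t b"
      using ex_rep[OF g] by blast
    then have "a \<otimes> b \<in> L" "b \<otimes> a \<in> L"
      using f'(3) L.I_l_closed L.I_r_closed by (auto simp: rep_def)
    then show "f \<otimes>\<^bsub>E\<^esub> g \<in> J" "g \<otimes>\<^bsub>E\<^esub> f \<in> J"
      using comp[OF f'(1) g f'(2) g'] comp[OF g f'(1) g' f'(2)] by auto
  next
    have zero_rep: "rep \<zero>\<^bsub>E\<^esub> \<one> \<zero>"
      using L.one_compl by (simp add: rep_def End_ring_simps)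
    have neg: "\<ominus>\<^bsub>E\<^esub> f \<in> J" if f: "f \<in> J" for f
    proof -
      have "f \<in> carrier E" "f \<notin> Units E"
        using f by (auto simp: J_def)
      \<comment> \<open>If the negative of \<open>f\<close> were a unit, so would be its product
        with the unit \<open>-1\<close>, which is \<open>f\<close>.\<close>
      moreover have "\<ominus>\<^bsub>E\<^esub> f \<in> Units E \<Longrightarrow> \<ominus>\<^bsub>E\<^esub> \<one>\<^bsub>E\<^esub> \<otimes>\<^bsub>E\<^esub> (\<ominus>\<^bsub>E\<^esub> f) \<in> Units E"
        using E.Units_minus_one_closed by (rule E.Units_m_closed)
      ultimately show ?thesis
        by (auto simp: J_def E.l_minus E.r_minus)
    qed
    show "subgroup J (add_monoid E)"
    proof
      fix f g assume fg: "f \<in> J" "g \<in> J"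
      then obtain s a t b where c: "f \<in> carrier E" "g \<in> carrier E" "rep f s a" "rep g t b"
          "a \<in> L" "b \<in> L"
        unfolding J_iff by blast
      then have d: "s \<in> carrier R - L" "t \<in> carrier R - L" "a \<in> carrier R" "b \<in> carrier R"
        by (auto simp: rep_def)
      have "(s \<otimes> t) \<odot>\<^bsub>N\<^esub> (f x \<oplus>\<^bsub>M\<^esub> g x) = (t \<otimes> a \<oplus> s \<otimes> b) \<odot>\<^bsub>N\<^esub> x" if x: "x \<in> carrier M" for x
      proof -
        have "(s \<otimes> t) \<odot>\<^bsub>N\<^esub> (f x \<oplus>\<^bsub>M\<^esub> g x) = t \<odot>\<^bsub>N\<^esub> (s \<odot>\<^bsub>N\<^esub> f x) \<oplus>\<^bsub>M\<^esub> s \<odot>\<^bsub>N\<^esub> (t \<odot>\<^bsub>N\<^esub> g x)"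
          using c(1,2) d x End_closed by (simp add: N.smult_r_distr N.smult_assoc1[symmetric] m_comm)
        also have "\<dots> = (t \<otimes> a \<oplus> s \<otimes> b) \<odot>\<^bsub>N\<^esub> x"
          using c(3,4) d x by (simp add: rep_def N.smult_l_distr N.smult_assoc1)
        finally show ?thesis .
      qed
      then have "rep (f \<oplus>\<^bsub>E\<^esub> g) (s \<otimes> t) (t \<otimes> a \<oplus> s \<otimes> b)"
        using d L.mult_compl[OF d(1,2)] by (simp add: rep_def End_ring_simps)
      moreover have "t \<otimes> a \<oplus> s \<otimes> b \<in> L"
        using c(5,6) d L.I_l_closed by simp
      ultimately show "f \<otimes>\<^bsub>add_monoid E\<^esub> g \<in> J"
        using E.a_closed[OF c(1,2)] unfolding J_iff by auto
    next
      have "\<zero>\<^bsub>E\<^esub> \<in> J"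
        using zero_rep additive_subgroup.zero_closed[OF L.is_additive_subgroup] E.zero_closed
        unfolding J_iff by blast
      then show "\<one>\<^bsub>add_monoid E\<^esub> \<in> J" by simp
      show "inv\<^bsub>add_monoid E\<^esub> f \<in> J" if "f \<in> J" for f
        using neg[OF that] by (simp add: a_inv_def)
    qed (auto simp: J_def)
  qed
  moreover have "carrier E \<noteq> {\<zero>\<^bsub>E\<^esub>}"
  proof
    assume "carrier E = {\<zero>\<^bsub>E\<^esub>}"
    then have "\<one>\<^bsub>E\<^esub> = \<zero>\<^bsub>E\<^esub>"
      using E.one_closed by auto
    then have "x = \<zero>\<^bsub>M\<^esub>" if "x \<in> carrier M" for x
      using that by (auto simp: End_ring_simps fun_eq_iff restrict_def split: if_splits)
    then show False
      using nz M.zero_closed by blast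
  qed
  ultimately show ?thesis
    by (simp add: local_ring_def E.ring_axioms J_def)
qed

text \<open>Structures are copied along maps injective on the carriers, with \<open>inv_into\<close>
  reading the elements back. This moves an example into prescribed carrier types while keeping the
  action of \<open>R\<close>.\<close>

lemma transport:
  fixes g :: "'s \<Rightarrow> 't" and h :: "'m \<Rightarrow> 'n"
  assumes g: "inj_on g (carrier S)" and h: "inj_on h (carrier M)"
  obtains S' :: "('a, 't) module" and M' :: "('t, 'n) module"
  where "algebra_module R S' M'" "carrier M' = h ` carrier M" "\<zero>\<^bsub>M'\<^esub> = h \<zero>\<^bsub>M\<^esub>"
    "\<And>r x. \<lbrakk>r \<in> carrier R; x \<in> carrier M\<rbrakk> \<Longrightarrow> r \<odot>\<^bsub>restrict_scalars S' M'\<^esub> h x = h (r \<odot>\<^bsub>N\<^esub> x)"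
proof -
  let ?g = "inv_into (carrier S) g" and ?h = "inv_into (carrier M) h"
  have [simp]: "\<And>x. x \<in> carrier S \<Longrightarrow> ?g (g x) = x" "\<And>x. x \<in> carrier M \<Longrightarrow> ?h (h x) = x"
    using g h by (simp_all add: inv_into_f_f)
  note [simp] = lsmult_closed
  define S' :: "('a, 't) module" where "S' =
    \<lparr>carrier = g ` carrier S, monoid.mult = \<lambda>x y. g (?g x \<otimes>\<^bsub>S\<^esub> ?g y), one = g \<one>\<^bsub>S\<^esub>,
     zero = g \<zero>\<^bsub>S\<^esub>, add = \<lambda>x y. g (?g x \<oplus>\<^bsub>S\<^esub> ?g y), smult = \<lambda>r x. g (r \<odot>\<^bsub>S\<^esub> ?g x)\<rparr>"
  \<comment> \<open>The ring multiplication and unit are left \<open>undefined\<close>, since these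
    fields carry no meaning in a module.\<close>
  define M' :: "('t, 'n) module" where "M' =
    \<lparr>carrier = h ` carrier M, monoid.mult = undefined, one = undefined,
     zero = h \<zero>\<^bsub>M\<^esub>, add = \<lambda>x y. h (?h x \<oplus>\<^bsub>M\<^esub> ?h y), smult = \<lambda>a x. h (?g a \<odot>\<^bsub>M\<^esub> ?h x)\<rparr>"
  have S'_simps [simp]: "carrier S' = g ` carrier S" "\<one>\<^bsub>S'\<^esub> = g \<one>\<^bsub>S\<^esub>" "\<zero>\<^bsub>S'\<^esub> = g \<zero>\<^bsub>S\<^esub>"
    "\<And>x y. x \<otimes>\<^bsub>S'\<^esub> y = g (?g x \<otimes>\<^bsub>S\<^esub> ?g y)" "\<And>x y. x \<oplus>\<^bsub>S'\<^esub> y = g (?g x \<oplus>\<^bsub>S\<^esub> ?g y)"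
    "\<And>r x. r \<odot>\<^bsub>S'\<^esub> x = g (r \<odot>\<^bsub>S\<^esub> ?g x)"
    by (simp_all add: S'_def)
  have M'_simps [simp]: "carrier M' = h ` carrier M" "\<zero>\<^bsub>M'\<^esub> = h \<zero>\<^bsub>M\<^esub>"
    "\<And>x y. x \<oplus>\<^bsub>M'\<^esub> y = h (?h x \<oplus>\<^bsub>M\<^esub> ?h y)" "\<And>a x. a \<odot>\<^bsub>M'\<^esub> x = h (?g a \<odot>\<^bsub>M\<^esub> ?h x)"
    by (simp_all add: M'_def)
  have group_S': "abelian_group S'"
  proof (rule abelian_groupI)
    fix x assume "x \<in> carrier S'"
    then show "\<exists>y\<in>carrier S'. y \<oplus>\<^bsub>S'\<^esub> x = \<zero>\<^bsub>S'\<^esub>"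
      by (auto simp: A.M.l_neg intro!: bexI[of _ "\<ominus>\<^bsub>S\<^esub> _"])
  qed (auto simp: A.M.a_ac)
  have group_M': "abelian_group M'"
  proof (rule abelian_groupI)
    fix x assume "x \<in> carrier M'"
    then show "\<exists>y\<in>carrier M'. y \<oplus>\<^bsub>M'\<^esub> x = \<zero>\<^bsub>M'\<^esub>"
      by (auto simp: L.M.l_neg intro!: bexI[of _ "\<ominus>\<^bsub>M\<^esub> _"])
  qed (auto simp: L.M.a_ac)
  have ring_S': "ring S'"
    by (rule ringI[OF group_S'])
      (auto intro!: monoidI simp: A.S.m_assoc A.S.l_distr A.S.r_distr)
  have "Module.module R S'"
    by (rule moduleI[OF is_cring group_S'])
      (auto simp: smult_l_distr smult_r_distr smult_assoc1)
  then have "unital_algebra R S'"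
    using ring_S'
    by (auto simp: unital_algebra_def unital_algebra_axioms_def smult_mult_left smult_mult_right)
  moreover have "left_module S' M'"
    using ring_S' group_M'
    by (auto simp: left_module_def left_module_axioms_def lsmult_l_distr lsmult_r_distr
        lsmult_assoc lsmult_one)
  ultimately have "algebra_module R S' M'"
    by (rule algebra_module.intro)
  moreover have "r \<odot>\<^bsub>restrict_scalars S' M'\<^esub> h x = h (r \<odot>\<^bsub>N\<^esub> x)"
    if "r \<in> carrier R" "x \<in> carrier M" for r x
    using that by (simp add: smult_restrict_scalars)
  ultimately show thesis
    using that[of S' M'] by simp
qed

text \<open>An element outside \<open>P\<close> is also outside \<open>L\<close>, so it acts
  injectively and kills no nonzero \<open>x\<close>.\<close>

lemma mem_Supp_if_localized:
  assumes P: "primeideal P R" and LP: "L \<subseteq> P" and nz: "carrier M \<noteq> {\<zero>\<^bsub>M\<^esub>}"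
    and bij: "\<And>s. s \<in> carrier R - L \<Longrightarrow> bij_betw (\<lambda>x. s \<odot>\<^bsub>N\<^esub> x) (carrier M) (carrier M)"
  shows "P \<in> Supp R S M"
proof -
  interpret P: primeideal P R by fact
  interpret MP: algebra_module_prime R S M P ..
  obtain x where x: "x \<in> carrier M" "x \<noteq> \<zero>\<^bsub>M\<^esub>"
    using nz M.zero_closed by blast
  have "u \<odot>\<^bsub>N\<^esub> x \<noteq> \<zero>\<^bsub>M\<^esub>" if u: "u \<in> carrier R - P" for u
  proof
    assume "u \<odot>\<^bsub>N\<^esub> x = \<zero>\<^bsub>M\<^esub>"
    then have "u \<odot>\<^bsub>N\<^esub> x = u \<odot>\<^bsub>N\<^esub> \<zero>\<^bsub>M\<^esub>"
      using u by simp
    moreover have "inj_on (\<lambda>x. u \<odot>\<^bsub>N\<^esub> x) (carrier M)"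
      using bij[of u] u LP by (auto simp: bij_betw_def)
    ultimately have "x = \<zero>\<^bsub>M\<^esub>"
      using x(1) M.zero_closed by (simp add: inj_on_def)
    then show False
      using x(2) by simp
  qed
  then show ?thesis
    unfolding MP.mem_Supp_iff using x(1) by blast
qed

end

section \<open>Scalars outside a prime ideal acting on the localization\<close>

context algebra_module_prime
begin

lemma algebra_module_localization: "algebra_module R S M\<^sub>P"
  using unital_algebra_axioms left_module_localization by (rule algebra_module.intro)

lemma smult_localization:
  "\<lbrakk>r \<in> carrier R; x \<in> carrier M; s \<in> carrier R - P\<rbrakk> \<Longrightarrow>
    r \<odot>\<^bsub>restrict_scalars S M\<^sub>P\<^esub> fr x s = fr (r \<odot>\<^bsub>N\<^esub> x) s"
  by (simp add: smult_restrict_scalars fr_smult)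

text \<open>For injectivity, a witness \<open>u\<close> after multiplying by \<open>s\<close> turns
  into the witness \<open>u \<otimes> s\<close> before it. For surjectivity, \<open>x/t\<close> is
  \<open>s\<close> times \<open>x/(st)\<close>.\<close>

lemma bij_betw_smult_localization:
  assumes s: "s \<in> carrier R - P"
  shows "bij_betw (\<lambda>X. s \<odot>\<^bsub>restrict_scalars S M\<^sub>P\<^esub> X) (carrier M\<^sub>P) (carrier M\<^sub>P)"
proof (rule bij_betwI')
  fix X Y assume "X \<in> carrier M\<^sub>P" "Y \<in> carrier M\<^sub>P"
  then obtain x y t w where c: "x \<in> carrier M" "y \<in> carrier M" "t \<in> carrier R - P" "w \<in> carrier R - P"
    and [simp]: "X = fr x t" "Y = fr y w"
    by (metis fr_cases)
  show "s \<odot>\<^bsub>restrict_scalars S M\<^sub>P\<^esub> X = s \<odot>\<^bsub>restrict_scalars S M\<^sub>P\<^esub> Y \<longleftrightarrow> X = Y"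
  proof
    assume "s \<odot>\<^bsub>restrict_scalars S M\<^sub>P\<^esub> X = s \<odot>\<^bsub>restrict_scalars S M\<^sub>P\<^esub> Y"
    then have "fr (s \<odot>\<^bsub>N\<^esub> x) t = fr (s \<odot>\<^bsub>N\<^esub> y) w"
      using s c by (simp add: smult_localization)
    then obtain u where u: "u \<in> carrier R - P"
      and "u \<odot>\<^bsub>N\<^esub> (w \<odot>\<^bsub>N\<^esub> (s \<odot>\<^bsub>N\<^esub> x)) = u \<odot>\<^bsub>N\<^esub> (t \<odot>\<^bsub>N\<^esub> (s \<odot>\<^bsub>N\<^esub> y))"
      using s c by (subst (asm) N.fraction_eq_iff) auto
    then have "(u \<otimes> s) \<odot>\<^bsub>N\<^esub> (w \<odot>\<^bsub>N\<^esub> x) = (u \<otimes> s) \<odot>\<^bsub>N\<^esub> (t \<odot>\<^bsub>N\<^esub> y)"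
      using s c by (simp add: N.smult_assoc1[symmetric] m_ac)
    then show "X = Y"
      using c mult_compl[OF u s] by (subst \<open>X = _\<close>, subst \<open>Y = _\<close>, subst N.fraction_eq_iff) auto
  qed simp
next
  fix X assume "X \<in> carrier M\<^sub>P"
  then obtain x t where "x \<in> carrier M" "t \<in> carrier R - P" "X = fr x t"
    by (rule fr_cases)
  then show "s \<odot>\<^bsub>restrict_scalars S M\<^sub>P\<^esub> X \<in> carrier M\<^sub>P"
    using s by (auto simp: smult_localization intro!: fr_closed)
next
  fix X assume "X \<in> carrier M\<^sub>P"
  then obtain x t where x: "x \<in> carrier M" "t \<in> carrier R - P" "X = fr x t"
    by (rule fr_cases)
  note st = mult_compl[OF s x(2)]
  have "X = s \<odot>\<^bsub>restrict_scalars S M\<^sub>P\<^esub> fr x (s \<otimes> t)"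
    unfolding x(3) using s x(1,2) st
    by (simp add: smult_localization, intro N.fraction_eqI) (auto simp: N.smult_assoc1[symmetric] m_comm)
  then show "\<exists>Y\<in>carrier M\<^sub>P. X = s \<odot>\<^bsub>restrict_scalars S M\<^sub>P\<^esub> Y"
    using fr_closed[OF x(1) st] by blast
qed

end

text \<open>\<open>S\<close> is a copy of \<open>R\<close>, and \<open>M\<close> is a copy of the
  localization of \<open>R\<close> at \<open>I\<close>. Infinity of \<open>R\<close> is what lets
  the fractions, chosen as pairs, be coded injectively by elements of \<open>R\<close> and hence
  placed in \<open>'m\<close>.\<close>

lemma (in primeideal) ex_algebra_module_local_End:
  fixes emb_s :: "'a \<Rightarrow> 's" and emb_m :: "'a \<Rightarrow> 'm"
  assumes inf: "infinite (carrier R)"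
    and emb_s: "inj_on emb_s (carrier R)" and emb_m: "inj_on emb_m (carrier R)"
  obtains S :: "('a, 's) module" and M :: "('s, 'm) module"
  where "algebra_module R S M" "local_ring (End_ring S M)"
    "\<And>P. \<lbrakk>primeideal P R; I \<subseteq> P\<rbrakk> \<Longrightarrow> P \<in> Supp R S M"
proof -
  let ?R = "regular_module R"
  have "left_module ?R ?R"
    using unital_algebra_regular_module
    by (auto simp: unital_algebra_def Module.module_def left_module_def left_module_axioms_def
        l_distr r_distr m_assoc)
  then interpret Q: algebra_module_prime R ?R ?R I
    by (intro algebra_module_prime.intro algebra_module.intro unital_algebra_regular_module
        primeideal_axioms)
  have act_reg: "r \<odot>\<^bsub>restrict_scalars ?R ?R\<^esub> x = r \<otimes> x" if "r \<in> carrier R" "x \<in> carrier R" for r x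
    using that by (simp add: smult_restrict_scalars)
  let ?K = "module_localization R ?R I ?R"
  interpret K: algebra_module R ?R ?K
    by (rule Q.algebra_module_localization)
  \<comment> \<open>An infinite set has the cardinality of its square, so pairs can be coded by
    single elements.\<close>
  obtain p where p: "inj_on p (carrier R \<times> carrier R)" "p ` (carrier R \<times> carrier R) \<subseteq> carrier R"
    using card_of_ordLeq[THEN iffD2, OF ordIso_imp_ordLeq[OF card_of_Times_same_infinite[OF inf]]]
    by blast
  let ?F = "\<lambda>(b, s). Q.fr b s" and ?D = "carrier R \<times> (carrier R - I)"
  have K_eq: "carrier ?K = ?F ` ?D"
    by (auto simp: Q.carrier_localization image_iff)
  \<comment> \<open>A fraction is sent to a chosen representing pair, then to the code of that pair,
    then into \<open>'m\<close>.\<close>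
  define h where "h = emb_m \<circ> (p \<circ> inv_into ?D ?F)"
  have "inj_on (inv_into ?D ?F) (carrier ?K)"
    unfolding K_eq by (rule inj_on_inv_into) simp
  moreover have q: "inv_into ?D ?F ` carrier ?K \<subseteq> carrier R \<times> carrier R"
    unfolding K_eq
    by (rule image_subsetI, drule inv_into_into, erule subsetD[rotated]) (rule Sigma_mono; blast)
  moreover have "p ` inv_into ?D ?F ` carrier ?K \<subseteq> carrier R"
    using image_mono[OF q] p(2) by (rule order_trans)
  ultimately have h: "inj_on h (carrier ?K)"
    unfolding h_def using inj_on_subset[OF p(1)] inj_on_subset[OF emb_m]
    by (intro comp_inj_on) (simp_all only: image_comp)
  obtain S :: "('a, 's) module" and M :: "('s, 'm) module"
    where SM: "algebra_module R S M" "carrier M = h ` carrier ?K" "\<zero>\<^bsub>M\<^esub> = h \<zero>\<^bsub>?K\<^esub>"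
    and act: "\<And>r x. \<lbrakk>r \<in> carrier R; x \<in> carrier ?K\<rbrakk> \<Longrightarrow>
        r \<odot>\<^bsub>restrict_scalars S M\<^esub> h x = h (r \<odot>\<^bsub>restrict_scalars ?R ?K\<^esub> x)"
    using K.transport[of emb_s h] emb_s h by auto
  interpret M: algebra_module R S M by fact
  have bij: "bij_betw (\<lambda>x. s \<odot>\<^bsub>restrict_scalars S M\<^esub> x) (carrier M) (carrier M)"
    if s: "s \<in> carrier R - I" for s
  proof -
    have bij_h: "bij_betw h (carrier ?K) (carrier M)"
      using h SM(2) by (simp add: bij_betw_def)
    \<comment> \<open>Multiplication by \<open>s\<close> on \<open>M\<close> is conjugate, via
      \<open>h\<close>, to multiplication by \<open>s\<close> on the localization.\<close>
    have "bij_betw (h \<circ> (\<lambda>x. s \<odot>\<^bsub>restrict_scalars ?R ?K\<^esub> x)) (carrier ?K) (carrier M)"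
      using Q.bij_betw_smult_localization[OF s] bij_h by (rule bij_betw_trans)
    then have "bij_betw ((\<lambda>x. s \<odot>\<^bsub>restrict_scalars S M\<^esub> x) \<circ> h) (carrier ?K) (carrier M)"
      using act s by (simp cong: bij_betw_cong)
    then show ?thesis
      using bij_betw_comp_iff[OF bij_h] by blast
  qed
  have fr1: "Q.fr \<one> \<one> \<in> carrier ?K"
    using one_compl by (intro Q.fr_closed) auto
  \<comment> \<open>If \<open>1/1\<close> were zero, some \<open>u\<close> outside \<open>I\<close>
    would be zero, yet \<open>\<zero>\<close> is in \<open>I\<close>.\<close>
  have "Q.fr \<one> \<one> \<noteq> \<zero>\<^bsub>?K\<^esub>"
    unfolding Q.zero_localization using one_compl
    by (subst Q.N.fraction_eq_iff) (auto simp: act_reg)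
  then have nz: "carrier M \<noteq> {\<zero>\<^bsub>M\<^esub>}"
    using fr1 h K.M.zero_closed unfolding SM by (auto dest: inj_onD)
  have "local_ring (End_ring S M)"
  proof (rule M.local_End_if_localized_cyclic[OF primeideal_axioms bij _ _ nz])
    \<comment> \<open>The generator is the image of \<open>1/1\<close>, since \<open>s\<close> times
      \<open>b/s\<close> equals \<open>b\<close> times \<open>1/1\<close>.\<close>
    show "h (Q.fr \<one> \<one>) \<in> carrier M"
      using fr1 SM(2) by simp
    fix x assume "x \<in> carrier M"
    then obtain b s where b: "b \<in> carrier R" and s: "s \<in> carrier R - I" and x: "x = h (Q.fr b s)"
      by (auto simp: SM(2) Q.carrier_localization)
    have "s \<odot>\<^bsub>restrict_scalars ?R ?K\<^esub> Q.fr b s = b \<odot>\<^bsub>restrict_scalars ?R ?K\<^esub> Q.fr \<one> \<one>"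
      using b s one_compl
      by (simp add: Q.smult_localization act_reg, intro Q.N.fraction_eqI) (auto simp: act_reg)
    then show "\<exists>s\<in>carrier R - I. \<exists>a\<in>carrier R. s \<odot>\<^bsub>restrict_scalars S M\<^esub> x
        = a \<odot>\<^bsub>restrict_scalars S M\<^esub> h (Q.fr \<one> \<one>)"
      using act b s fr1 Q.fr_closed[of b s] unfolding x by (metis DiffD1 regular_module_simps(1))
  qed
  moreover have "P \<in> Supp R S M" if "primeideal P R" "I \<subseteq> P" for P
    using M.mem_Supp_if_localized[OF that nz bij] .
  ultimately show thesis
    using that SM(1) by blast
qed

text \<open>The embeddings make \<open>'s\<close> and \<open>'m\<close> large enough to hold the
  example built from \<open>R\<close> when the first condition is a hypothesis. The final claim
  ranges over carrier types \<open>'t\<close> and \<open>'n\<close> of its own.\<close>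

theorem proposition3p1:
  fixes R :: "('a, 'x) ring_scheme"
    and emb_s :: "'a \<Rightarrow> 's"
    and emb_m :: "'a \<Rightarrow> 'm"
  assumes "cring R"
    and "inj_on emb_s (carrier R)"
    and "inj_on emb_m (carrier R)"
  shows
    "((\<forall>(S :: ('a, 's) module) (M :: ('s, 'm) module).
         unital_algebra R S \<and> left_module S M \<and> local_ring (End_ring S M)
         \<longrightarrow> (\<exists>!P. P \<in> Supp R S M \<inter> Max_Spec R))
       \<longleftrightarrow> gelfand_ring R)
     \<and> (gelfand_ring R
       \<longleftrightarrow> (\<forall>P\<in>Max_Spec R.
             to_ring_localization R P ` carrier R = carrier (ring_localization R P)))
     \<and> (gelfand_ring R \<longrightarrow>
         (\<forall>(S :: ('a, 't) module) (M :: ('t, 'n) module).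
           unital_algebra R S \<and> left_module S M \<and> local_ring (End_ring S M)
           \<longrightarrow> (\<exists>P. Supp R S M \<inter> Max_Spec R = {P}
                 \<and> to_module_localization R S P M
                     \<in> lmod_iso S M (module_localization R S P M))))"
proof (intro conjI)
  interpret cring R by fact
  show "gelfand_ring R \<longleftrightarrow> (\<forall>P\<in>Max_Spec R.
      to_ring_localization R P ` carrier R = carrier (ring_localization R P))"
    by (rule gelfand_ring_iff_localization_surj)
  show "gelfand_ring R \<longrightarrow>
      (\<forall>(S :: ('a, 't) module) (M :: ('t, 'n) module).
        unital_algebra R S \<and> left_module S M \<and> local_ring (End_ring S M)
        \<longrightarrow> (\<exists>P. Supp R S M \<inter> Max_Spec R = {P}
              \<and> to_module_localization R S P M
                  \<in> lmod_iso S M (module_localization R S P M)))"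
    by (intro allI impI, elim conjE) (rule algebra_module.local_End_Supp[OF algebra_module.intro])
  show "(\<forall>(S :: ('a, 's) module) (M :: ('s, 'm) module).
      unital_algebra R S \<and> left_module S M \<and> local_ring (End_ring S M)
      \<longrightarrow> (\<exists>!P. P \<in> Supp R S M \<inter> Max_Spec R)) \<longleftrightarrow> gelfand_ring R"
    (is "?unique \<longleftrightarrow> _")
  proof
    assume unique: ?unique
    show "gelfand_ring R"
    \<comment> \<open>Coding pairs by single elements requires an infinite \<open>R\<close>; finite
      rings are Gelfand for a direct reason.\<close>
    proof (cases "finite (carrier R)")
      case True
      then show ?thesis by (rule gelfand_ring_if_finite)
    next
      case False
      have "P = Q" if L: "primeideal L R" and P: "maximalideal P R" "L \<subseteq> P"
        and Q: "maximalideal Q R" "L \<subseteq> Q" for L P Q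
      proof -
        obtain S :: "('a, 's) module" and M :: "('s, 'm) module"
          where SM: "algebra_module R S M" "local_ring (End_ring S M)"
            and supp: "\<And>P. \<lbrakk>primeideal P R; L \<subseteq> P\<rbrakk> \<Longrightarrow> P \<in> Supp R S M"
          using primeideal.ex_algebra_module_local_End[OF L False assms(2,3)] by blast
        have ex1: "\<exists>!P. P \<in> Supp R S M \<inter> Max_Spec R"
          using unique SM by (simp add: algebra_module_def)
        \<comment> \<open>The module built at \<open>L\<close> has every prime above
          \<open>L\<close> in its support, in particular both maximal ideals.\<close>
        have "P \<in> Supp R S M \<inter> Max_Spec R" "Q \<in> Supp R S M \<inter> Max_Spec R"
          using supp maximalideal_prime P Q by (auto simp: Max_Spec_def)
        with ex1 show ?thesis by (elim ex1E) metis
      qed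
      then show ?thesis
        unfolding gelfand_ring_iff by blast
    qed
  next
    assume G: "gelfand_ring R"
    show ?unique
    proof (intro allI impI, elim conjE)
      fix S :: "('a, 's) module" and M :: "('s, 'm) module"
      assume "unital_algebra R S" "left_module S M" "local_ring (End_ring S M)"
      then obtain P where "Supp R S M \<inter> Max_Spec R = {P}"
        using algebra_module.local_End_Supp[OF algebra_module.intro G] by blast
      then show "\<exists>!P. P \<in> Supp R S M \<inter> Max_Spec R"
        by simp
    qed
  qed
qed

end
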